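(* Let $k\ge 1$ be an integer, let $G_{2k}$ be the set of the $2^{2k}$ generators $e_\mu$ ($\mu$ a strictly increasing sequence in $\{1,\dots,2k\}$) of $Cl(\mathbb{C}^{2k})$, and consider the equivalence classes of the relation $\sim$ on $G_{2k}$. The following hold for all $k\ge 1$. (1) Each equivalence class has the same size, namely $2^{k-1}$. (2) There are a total of $2^{k+1}$ equivalence classes: $2^k$ real equivalence classes and $2^k$ imaginary equivalence classes. (3) There are $2^k$ distinct shapes occurring among the equivalence classes, and each one occurs in two classes: an imaginary class and a real class. (4) There are exactly as many $e_\eta$ in a given class with even-length $\eta$ as with odd-length $\eta$. That is, for each equivalence class $[e_\mu]$, $|\{e_\eta\in[e_\mu]: |\eta|\text{ is even}\}|=|\{e_\eta\in[e_\mu]:|\eta|\text{ is odd}\}|$, where $|\eta|$ denotes the length of the increasing sequence $\eta$.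
   Context: Clifford algebra: $Cl(\mathbb{C}^{2k})$ is the unital associative complex algebra generated by $e_1,\dots,e_{2k}$ with $e_j^2=-1$ and $e_je_l=-e_le_j$ for $j\neq l$. For a sequence $\mu=(i_1,\dots,i_l)$ in $\{1,\dots,2k\}$ put $e_\mu=e_{i_1}\cdots e_{i_l}$, with $e_\emptyset=1$. Representation: let $E_1=\begin{pmatrix} i&0\\0&-i\end{pmatrix}$, $E_2=\begin{pmatrix}0&i\\i&0\end{pmatrix}$, $B=\begin{pmatrix}0&-i\\i&0\end{pmatrix}$, and $I_2$ the $2\times2$ identity. The algebra isomorphism $\rho:Cl(\mathbb{C}^{2k})\to \mathrm{Mat}_{2^k}(\mathbb{C})$ is determined by $\rho(e_{2j-1})=I_2^{\otimes (k-j)}\otimes E_1\otimes B^{\otimes (j-1)}$ and $\rho(e_{2j})=I_2^{\otimes (k-j)}\otimes E_2\otimes B^{\otimes (j-1)}$ for $1\le j\le k$, where $\otimes$ is the Kronecker product (the block matrix $M\otimes N$ has blocks $m_{ab}N$). Torus: $S_{\Delta_{2k}}=\mathbb{C}^{2^k}/(\mathbb{Z}^{2^k}\oplus i\mathbb{Z}^{2^k})$, $J_2^{S_{\Delta_{2k}}}=\{x\in S_{\Delta_{2k}}:2x=0\}$. The matrices $\rho(e_\mu)$ have entries in $\mathbb{Z}[i]$ and so act on $J_2^{S_{\Delta_{2k}}}$. Equivalence: $e_\mu\sim e_\eta$ iff $\rho(e_\mu)\vec v=\rho(e_\eta)\vec v$ for all $\vec v\in J_2^{S_{\Delta_{2k}}}$;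 $[e_\mu]$ is the class of $e_\mu$. Shape: for a complex square matrix $M=(m_{ij})$, its shape $\mathrm{Sh}(M)$ is the 0/1 matrix with entry $1$ exactly where $m_{ij}\ne0$. Elements of one class have representing matrices of the same shape; the shape of a class is this common shape. Type: $e_\mu$ is of real type if all nonzero entries of $\rho(e_\mu)$ lie in $\{1,-1\}$, and of imaginary type if all nonzero entries lie in $\{i,-i\}$. Every $e_\mu$ has exactly one of these types, and all elements of a class have the same type; the class is called real or imaginary accordingly.
   Formalization: Part (4) is stated only for k ≥ 2, since for k = 1 it is false: by (1) each class then has a single element, so it cannot contain equally many even-length and odd-length words; parts (1)–(3) are stated for all k ≥ 1. *)

theory Defs
  imports
    "HOL-Algebra.QuotRing"
    "HOL-Algebra.Module"
    "Jordan_Normal_Form.Matrix"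
begin

section \<open>The complex Clifford algebra by generators and relations\<close>

text \<open>The free unital associative complex algebra on the letters \<open>1, \<dots>, n\<close>: finitely supported
  functions on words, with the convolution product induced by concatenation of words.\<close>

definition free_algebra :: "nat \<Rightarrow> (complex, nat list \<Rightarrow> complex) module" where
  "free_algebra n = \<lparr>
     carrier = {p. finite {w. p w \<noteq> 0} \<and> (\<forall>w. p w \<noteq> 0 \<longrightarrow> set w \<subseteq> {1..n})},
     monoid.mult = (\<lambda>p q w. \<Sum>i\<le>length w. p (take i w) * q (drop i w)),
     one = (\<lambda>w. if w = [] then 1 else 0),
     zero = (\<lambda>_. 0),
     add = (\<lambda>p q w. p w + q w),
     smult = (\<lambda>c p w. c * p w)\<rparr>"

definition letter :: "nat \<Rightarrow> nat list \<Rightarrow> complex" where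
  "letter j = (\<lambda>w. if w = [j] then 1 else 0)"

definition clifford_relators :: "nat \<Rightarrow> (nat list \<Rightarrow> complex) set" where
  "clifford_relators n =
     {(letter j \<otimes>\<^bsub>free_algebra n\<^esub> letter j) \<oplus>\<^bsub>free_algebra n\<^esub> \<one>\<^bsub>free_algebra n\<^esub> | j. j \<in> {1..n}} \<union>
     {(letter j \<otimes>\<^bsub>free_algebra n\<^esub> letter l) \<oplus>\<^bsub>free_algebra n\<^esub>
      (letter l \<otimes>\<^bsub>free_algebra n\<^esub> letter j) | j l. j \<in> {1..n} \<and> l \<in> {1..n} \<and> j \<noteq> l}"

definition clifford_ideal :: "nat \<Rightarrow> (nat list \<Rightarrow> complex) set" where
  "clifford_ideal n = Idl\<^bsub>free_algebra n\<^esub> (clifford_relators n)"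

text \<open>The quotient ring, extended by the scalar multiplication that the ideal (which is a linear
  subspace, the free algebra being unital) induces on cosets, in the same style as
  \<^const>\<open>rcoset_mult\<close>.\<close>

definition clifford :: "nat \<Rightarrow> (complex, (nat list \<Rightarrow> complex) set) module" where
  "clifford n = ring.extend (free_algebra n Quot clifford_ideal n)
     \<lparr>smult = (\<lambda>c X. \<Union>p\<in>X. clifford_ideal n +>\<^bsub>free_algebra n\<^esub> (c \<odot>\<^bsub>free_algebra n\<^esub> p))\<rparr>"

definition clifford_gen :: "nat \<Rightarrow> nat \<Rightarrow> (nat list \<Rightarrow> complex) set" where
  "clifford_gen n j = clifford_ideal n +>\<^bsub>free_algebra n\<^esub> letter j"

definition clifford_word :: "nat \<Rightarrow> nat list \<Rightarrow> (nat list \<Rightarrow> complex) set" where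
  "clifford_word n \<mu> = foldr (\<lambda>j x. clifford_gen n j \<otimes>\<^bsub>clifford n\<^esub> x) \<mu> \<one>\<^bsub>clifford n\<^esub>"

definition increasing_seqs :: "nat \<Rightarrow> nat list set" where
  "increasing_seqs n = {\<mu>. sorted_wrt (<) \<mu> \<and> set \<mu> \<subseteq> {1..n}}"

definition clifford_generators :: "nat \<Rightarrow> (nat list \<Rightarrow> complex) set set" where
  "clifford_generators n = clifford_word n ` increasing_seqs n"

section \<open>The spin representation\<close>

definition kronecker :: "complex mat \<Rightarrow> complex mat \<Rightarrow> complex mat" where
  "kronecker M N = mat (dim_row M * dim_row N) (dim_col M * dim_col N)
     (\<lambda>(r, c). M $$ (r div dim_row N, c div dim_col N) * N $$ (r mod dim_row N, c mod dim_col N))"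

primrec kronecker_power :: "complex mat \<Rightarrow> nat \<Rightarrow> complex mat" where
  "kronecker_power M 0 = 1\<^sub>m 1"
| "kronecker_power M (Suc m) = kronecker M (kronecker_power M m)"

definition E1 :: "complex mat" where
  "E1 = mat_of_rows_list 2 [[\<i>, 0], [0, - \<i>]]"

definition E2 :: "complex mat" where
  "E2 = mat_of_rows_list 2 [[0, \<i>], [\<i>, 0]]"

definition B :: "complex mat" where
  "B = mat_of_rows_list 2 [[0, - \<i>], [\<i>, 0]]"

definition algebra_iso ::
  "('c, 'a) module \<Rightarrow> ('c, 'b) module \<Rightarrow> ('a \<Rightarrow> 'b) set" where
  "algebra_iso R S = {h \<in> ring_iso R S. \<forall>c. \<forall>x\<in>carrier R. h (c \<odot>\<^bsub>R\<^esub> x) = c \<odot>\<^bsub>S\<^esub> h x}"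

text \<open>Since the generators generate the algebra, the values below determine \<open>\<rho>\<close> on the carrier.\<close>

definition spin_rep :: "nat \<Rightarrow> ((nat list \<Rightarrow> complex) set \<Rightarrow> complex mat) \<Rightarrow> bool" where
  "spin_rep k \<rho> \<longleftrightarrow>
     \<rho> \<in> algebra_iso (clifford (2 * k)) (module_mat TYPE(complex) (2 ^ k) (2 ^ k)) \<and>
     (\<forall>j\<in>{1..k}.
        \<rho> (clifford_gen (2 * k) (2 * j - 1)) =
          kronecker (kronecker (kronecker_power (1\<^sub>m 2) (k - j)) E1) (kronecker_power B (j - 1)) \<and>
        \<rho> (clifford_gen (2 * k) (2 * j)) =
          kronecker (kronecker (kronecker_power (1\<^sub>m 2) (k - j)) E2) (kronecker_power B (j - 1)))"

section \<open>The torus and its 2-torsion points\<close>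

definition gauss_lattice :: "nat \<Rightarrow> complex vec set" where
  "gauss_lattice m = {v \<in> carrier_vec m. \<forall>i<m. Re (v $ i) \<in> \<int> \<and> Im (v $ i) \<in> \<int>}"

text \<open>The quotient group is a \<^typ>\<open>complex vec set monoid\<close>, so its addition is written
  multiplicatively.\<close>

definition spin_torus :: "nat \<Rightarrow> complex vec set monoid" where
  "spin_torus k = module_vec TYPE(complex) (2 ^ k) A_Mod gauss_lattice (2 ^ k)"

definition two_torsion :: "nat \<Rightarrow> complex vec set set" where
  "two_torsion k =
     {x \<in> carrier (spin_torus k). x \<otimes>\<^bsub>spin_torus k\<^esub> x = \<one>\<^bsub>spin_torus k\<^esub>}"

text \<open>The action induced on cosets by a matrix preserving the lattice.\<close>

definition torus_act :: "nat \<Rightarrow> complex mat \<Rightarrow> complex vec set \<Rightarrow> complex vec set" where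
  "torus_act k M X =
     (\<Union>v\<in>X. gauss_lattice (2 ^ k) +>\<^bsub>module_vec TYPE(complex) (2 ^ k)\<^esub> (M *\<^sub>v v))"

section \<open>Equivalence classes, shapes and types\<close>

definition spin_equiv ::
  "nat \<Rightarrow> ((nat list \<Rightarrow> complex) set \<Rightarrow> complex mat) \<Rightarrow> (nat list \<Rightarrow> complex) set rel" where
  "spin_equiv k \<rho> =
     {(x, y). x \<in> clifford_generators (2 * k) \<and> y \<in> clifford_generators (2 * k) \<and>
        (\<forall>v\<in>two_torsion k. torus_act k (\<rho> x) v = torus_act k (\<rho> y) v)}"

definition spin_classes ::
  "nat \<Rightarrow> ((nat list \<Rightarrow> complex) set \<Rightarrow> complex mat) \<Rightarrow> (nat list \<Rightarrow> complex) set set set" where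
  "spin_classes k \<rho> = clifford_generators (2 * k) // spin_equiv k \<rho>"

text \<open>For \<open>k = 1\<close> the four classes are singletons, so a class cannot contain equally many words of
  even and of odd length; that balance can only be claimed for \<open>k \<ge> 2\<close>.\<close>

definition shape :: "complex mat \<Rightarrow> nat mat" where
  "shape M = map_mat (\<lambda>z. if z \<noteq> 0 then 1 else 0) M"

definition class_shape ::
  "('a \<Rightarrow> complex mat) \<Rightarrow> 'a set \<Rightarrow> nat mat" where
  "class_shape \<rho> C = (THE s. \<forall>x\<in>C. shape (\<rho> x) = s)"

definition nonzero_entries :: "complex mat \<Rightarrow> complex set" where
  "nonzero_entries M = elements_mat M - {0}"

definition real_type :: "('a \<Rightarrow> complex mat) \<Rightarrow> 'a \<Rightarrow> bool" where
  "real_type \<rho> x \<longleftrightarrow> nonzero_entries (\<rho> x) \<subseteq> {1, - 1}"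

definition imaginary_type :: "('a \<Rightarrow> complex mat) \<Rightarrow> 'a \<Rightarrow> bool" where
  "imaginary_type \<rho> x \<longleftrightarrow> nonzero_entries (\<rho> x) \<subseteq> {\<i>, - \<i>}"

definition real_class :: "('a \<Rightarrow> complex mat) \<Rightarrow> 'a set \<Rightarrow> bool" where
  "real_class \<rho> C \<longleftrightarrow> (\<forall>x\<in>C. real_type \<rho> x)"

definition imaginary_class :: "('a \<Rightarrow> complex mat) \<Rightarrow> 'a set \<Rightarrow> bool" where
  "imaginary_class \<rho> C \<longleftrightarrow> (\<forall>x\<in>C. imaginary_type \<rho> x)"

end

theory Submission
  imports Defs
begin

text \<open>Number the rows and columns from 0, so that the binary digits of an index correspond to the
  tensor factors. Each \<open>2 \<times> 2\<close> factor of \<open>\<rho>(e\<^sub>j)\<close> is diagonal or antidiagonal, so \<open>\<rho>(e\<^sub>\<mu>)\<close> is monomial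
  with its nonzero entries at the positions \<open>(r, r XOR m)\<close>, all in \<open>{1, - 1}\<close> or all in \<open>{\<i>, - \<i>}\<close>. The
  mask \<open>m\<close> and the type \<open>t\<close> depend additively on \<open>\<mu>\<close> over the field with two elements. Testing the
  action on halves of unit vectors shows that \<open>e\<^sub>\<mu> \<sim> e\<^sub>\<eta>\<close> exactly when the pairs \<open>(m, t)\<close> agree, so the
  classes are the fibres of \<open>\<mu> \<mapsto> (m, t)\<close>. Distinct increasing sequences give distinct elements because
  they have different commutation signs with the generators. The fibres, split by the parity of
  \<open>|\<mu>|\<close>, are counted by induction on \<open>k\<close>: passing from \<open>k\<close> to \<open>k + 1\<close>, bit \<open>k\<close> of \<open>m\<close> decides whether
  \<open>2 * k + 2\<close> occurs in \<open>\<mu>\<close>, while \<open>2 * k + 1\<close> can be chosen freely.\<close>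

unbundle bit_operations_syntax

section \<open>The Clifford algebra as a ring\<close>

lemma free_algebra_carrier:
  "p \<in> carrier (free_algebra n) \<longleftrightarrow> finite {w. p w \<noteq> 0} \<and> (\<forall>w. p w \<noteq> 0 \<longrightarrow> set w \<subseteq> {1..n})"
  by (simp add: free_algebra_def)

lemma free_algebra_ops:
  "p \<otimes>\<^bsub>free_algebra n\<^esub> q = (\<lambda>w. \<Sum>i\<le>length w. p (take i w) * q (drop i w))"
  "\<one>\<^bsub>free_algebra n\<^esub> = (\<lambda>w. if w = [] then 1 else 0)"
  "\<zero>\<^bsub>free_algebra n\<^esub> = (\<lambda>_. 0)"
  "p \<oplus>\<^bsub>free_algebra n\<^esub> q = (\<lambda>w. p w + q w)"
  by (simp_all add: free_algebra_def)

text \<open>A word in the support of a product is a concatenation of words from the two supports, so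
  only finitely many words occur.\<close>

lemma free_algebra_mult_closed:
  assumes "p \<in> carrier (free_algebra n)" and "q \<in> carrier (free_algebra n)"
  shows "p \<otimes>\<^bsub>free_algebra n\<^esub> q \<in> carrier (free_algebra n)"
proof -
  have split: "\<exists>u v. w = u @ v \<and> p u \<noteq> 0 \<and> q v \<noteq> 0" if w: "(p \<otimes>\<^bsub>free_algebra n\<^esub> q) w \<noteq> 0" for w
  proof -
    obtain i where "p (take i w) * q (drop i w) \<noteq> 0"
      using w unfolding free_algebra_ops by (metis (no_types, lifting) sum.neutral)
    then show ?thesis
      by (intro exI[of _ "take i w"] exI[of _ "drop i w"]) auto
  qed
  have "{w. (p \<otimes>\<^bsub>free_algebra n\<^esub> q) w \<noteq> 0} \<subseteq>
      (\<lambda>(u, v). u @ v) ` ({w. p w \<noteq> 0} \<times> {w. q w \<noteq> 0})"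
    using split by force
  moreover have "finite ({w. p w \<noteq> 0} \<times> {w. q w \<noteq> 0})"
    using assms by (simp add: free_algebra_carrier)
  ultimately have "finite {w. (p \<otimes>\<^bsub>free_algebra n\<^esub> q) w \<noteq> 0}"
    by (meson finite_imageI finite_subset)
  moreover have "set w \<subseteq> {1..n}" if "(p \<otimes>\<^bsub>free_algebra n\<^esub> q) w \<noteq> 0" for w
    using split[OF that] assms unfolding free_algebra_carrier by fastforce
  ultimately show ?thesis
    by (simp add: free_algebra_carrier)
qed

text \<open>Both sides sum over all cuts of \<open>w\<close> into three consecutive pieces. The left
  side records the ends \<open>i\<close> and \<open>j\<close> of the second and first piece, the
  right side the end \<open>j\<close> of the first and the length \<open>d = i - j\<close> of the
  second.\<close>

lemma free_algebra_mult_assoc: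
  "(p \<otimes>\<^bsub>free_algebra n\<^esub> q) \<otimes>\<^bsub>free_algebra n\<^esub> r = p \<otimes>\<^bsub>free_algebra n\<^esub> (q \<otimes>\<^bsub>free_algebra n\<^esub> r)"
proof
  fix w :: "nat list"
  let ?l = "length w"
  have "((p \<otimes>\<^bsub>free_algebra n\<^esub> q) \<otimes>\<^bsub>free_algebra n\<^esub> r) w =
      (\<Sum>i\<le>?l. \<Sum>j\<le>i. p (take j w) * q (drop j (take i w)) * r (drop i w))"
    unfolding free_algebra_ops by (auto simp: sum_distrib_right min_def intro!: sum.cong)
  also have "\<dots> = (\<Sum>(i, j)\<in>(SIGMA i:{..?l}. {..i}). p (take j w) * q (drop j (take i w)) * r (drop i w))"
    by (simp add: sum.Sigma)
  also have "\<dots> = (\<Sum>(j, d)\<in>(SIGMA j:{..?l}. {..?l - j}).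
      p (take j w) * (q (take d (drop j w)) * r (drop (d + j) w)))"
    by (rule sum.reindex_bij_witness[of _ "\<lambda>(j, d). (d + j, j)" "\<lambda>(i, j). (j, i - j)"])
      (auto simp: drop_take)
  also have "\<dots> = (\<Sum>j\<le>?l. \<Sum>d\<le>?l - j. p (take j w) * (q (take d (drop j w)) * r (drop (d + j) w)))"
    by (simp add: sum.Sigma)
  also have "\<dots> = (p \<otimes>\<^bsub>free_algebra n\<^esub> (q \<otimes>\<^bsub>free_algebra n\<^esub> r)) w"
    unfolding free_algebra_ops by (simp add: sum_distrib_left)
  finally show "((p \<otimes>\<^bsub>free_algebra n\<^esub> q) \<otimes>\<^bsub>free_algebra n\<^esub> r) w =
      (p \<otimes>\<^bsub>free_algebra n\<^esub> (q \<otimes>\<^bsub>free_algebra n\<^esub> r)) w" .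
qed

lemma free_algebra_ring: "ring (free_algebra n)"
proof (rule ringI)
  show "abelian_group (free_algebra n)"
  proof (rule abelian_groupI)
    fix p q assume "p \<in> carrier (free_algebra n)" "q \<in> carrier (free_algebra n)"
    moreover have "{w. p w + q w \<noteq> 0} \<subseteq> {w. p w \<noteq> 0} \<union> {w. q w \<noteq> 0}"
      by auto
    ultimately show "p \<oplus>\<^bsub>free_algebra n\<^esub> q \<in> carrier (free_algebra n)"
      unfolding free_algebra_carrier free_algebra_ops
      by (metis (mono_tags, lifting) add.right_neutral add_0 finite_Un finite_subset)
  next
    fix p assume p: "p \<in> carrier (free_algebra n)"
    show "\<exists>q\<in>carrier (free_algebra n). q \<oplus>\<^bsub>free_algebra n\<^esub> p = \<zero>\<^bsub>free_algebra n\<^esub>"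
      using p by (intro bexI[of _ "\<lambda>w. - p w"]) (simp_all add: free_algebra_ops free_algebra_carrier)
  qed (auto simp: free_algebra_ops free_algebra_carrier algebra_simps)
next
  show "Group.monoid (free_algebra n)"
  proof (rule monoidI)
    show "\<one>\<^bsub>free_algebra n\<^esub> \<in> carrier (free_algebra n)"
      by (auto simp: free_algebra_ops free_algebra_carrier split: if_splits)
  next
    fix p
    show "\<one>\<^bsub>free_algebra n\<^esub> \<otimes>\<^bsub>free_algebra n\<^esub> p = p"
    proof
      fix w :: "nat list"
      have "(\<one>\<^bsub>free_algebra n\<^esub> \<otimes>\<^bsub>free_algebra n\<^esub> p) w = (\<Sum>i\<le>length w. if i = 0 then p w else 0)"
        unfolding free_algebra_ops by (rule sum.cong) auto
      then show "(\<one>\<^bsub>free_algebra n\<^esub> \<otimes>\<^bsub>free_algebra n\<^esub> p) w = p w"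
        by simp
    qed
    show "p \<otimes>\<^bsub>free_algebra n\<^esub> \<one>\<^bsub>free_algebra n\<^esub> = p"
    proof
      fix w :: "nat list"
      have "(p \<otimes>\<^bsub>free_algebra n\<^esub> \<one>\<^bsub>free_algebra n\<^esub>) w =
          (\<Sum>i\<le>length w. if i = length w then p w else 0)"
        unfolding free_algebra_ops by (rule sum.cong) auto
      then show "(p \<otimes>\<^bsub>free_algebra n\<^esub> \<one>\<^bsub>free_algebra n\<^esub>) w = p w"
        by simp
    qed
  qed (simp_all add: free_algebra_mult_closed free_algebra_mult_assoc)
qed (simp_all add: free_algebra_ops algebra_simps sum.distrib)

section \<open>Generators, words and the anticommutation relation in the quotient\<close>

lemma letter_in_free_algebra:
  "j \<in> {1..n} \<Longrightarrow> letter j \<in> carrier (free_algebra n)"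
  by (auto simp: letter_def free_algebra_carrier split: if_splits)

lemma clifford_relators_subset: "clifford_relators n \<subseteq> carrier (free_algebra n)"
proof -
  interpret ring "free_algebra n" by (rule free_algebra_ring)
  show ?thesis
    unfolding clifford_relators_def using letter_in_free_algebra by auto
qed

lemma clifford_ideal: "ideal (clifford_ideal n) (free_algebra n)"
  unfolding clifford_ideal_def
  by (rule ring.genideal_ideal[OF free_algebra_ring clifford_relators_subset])

lemma clifford_ops:
  "carrier (clifford n) = carrier (free_algebra n Quot clifford_ideal n)"
  "x \<otimes>\<^bsub>clifford n\<^esub> y = x \<otimes>\<^bsub>free_algebra n Quot clifford_ideal n\<^esub> y"
  "x \<oplus>\<^bsub>clifford n\<^esub> y = x \<oplus>\<^bsub>free_algebra n Quot clifford_ideal n\<^esub> y"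
  "\<one>\<^bsub>clifford n\<^esub> = \<one>\<^bsub>free_algebra n Quot clifford_ideal n\<^esub>"
  "\<zero>\<^bsub>clifford n\<^esub> = \<zero>\<^bsub>free_algebra n Quot clifford_ideal n\<^esub>"
  by (simp_all add: clifford_def ring.defs)

text \<open>\<open>clifford\<close> extends the quotient ring only by a scalar multiplication, so
  the ring axioms carry over field by field.\<close>

lemma clifford_ring: "ring (clifford n)"
proof -
  interpret Q: ring "free_algebra n Quot clifford_ideal n"
    by (rule ideal.quotient_is_ring[OF clifford_ideal])
  show ?thesis
    by (intro ringI abelian_groupI monoidI)
      (auto simp: clifford_ops Q.a_ac Q.m_assoc Q.l_distr Q.r_distr
        intro: Q.add.l_inv_ex[simplified])
qed

lemma clifford_proj_hom:
  "(+>\<^bsub>free_algebra n\<^esub>) (clifford_ideal n) \<in> Ring.ring_hom (free_algebra n) (clifford n)"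
  using ideal.rcos_ring_hom[OF clifford_ideal, of n]
  by (simp add: Ring.ring_hom_def clifford_ops)

lemma clifford_gen_closed: "j \<in> {1..n} \<Longrightarrow> clifford_gen n j \<in> carrier (clifford n)"
  unfolding clifford_gen_def
  by (rule ring_hom_closed[OF clifford_proj_hom letter_in_free_algebra])

lemma clifford_word_closed:
  "set \<mu> \<subseteq> {1..n} \<Longrightarrow> clifford_word n \<mu> \<in> carrier (clifford n)"
proof -
  interpret ring "clifford n" by (rule clifford_ring)
  show "set \<mu> \<subseteq> {1..n} \<Longrightarrow> clifford_word n \<mu> \<in> carrier (clifford n)"
    by (induction \<mu>) (use clifford_gen_closed in \<open>auto simp: clifford_word_def\<close>)
qed

lemma clifford_relator_zero:
  assumes "x \<in> clifford_relators n"
  shows "clifford_ideal n +>\<^bsub>free_algebra n\<^esub> x = \<zero>\<^bsub>clifford n\<^esub>"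
proof -
  interpret F: ring "free_algebra n" by (rule free_algebra_ring)
  interpret I: ideal "clifford_ideal n" "free_algebra n" by (rule clifford_ideal)
  have "x \<in> clifford_ideal n"
    using assms F.genideal_self[OF clifford_relators_subset] unfolding clifford_ideal_def by blast
  then show ?thesis
    by (simp add: clifford_ops FactRing_def I.a_rcos_const)
qed

text \<open>The projection is a ring homomorphism that sends the relator for \<open>j\<close> and
  \<open>l\<close> to zero.\<close>

lemma clifford_gen_anticommute:
  assumes "j \<in> {1..n}" "l \<in> {1..n}" "j \<noteq> l"
  shows "clifford_gen n j \<otimes>\<^bsub>clifford n\<^esub> clifford_gen n l \<oplus>\<^bsub>clifford n\<^esub>
    clifford_gen n l \<otimes>\<^bsub>clifford n\<^esub> clifford_gen n j = \<zero>\<^bsub>clifford n\<^esub>"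
proof -
  interpret F: ring "free_algebra n" by (rule free_algebra_ring)
  interpret ring_hom_ring "free_algebra n" "clifford n" "(+>\<^bsub>free_algebra n\<^esub>) (clifford_ideal n)"
    by (intro ring_hom_ringI2 free_algebra_ring clifford_ring clifford_proj_hom)
  let ?x = "letter j \<otimes>\<^bsub>free_algebra n\<^esub> letter l \<oplus>\<^bsub>free_algebra n\<^esub> letter l \<otimes>\<^bsub>free_algebra n\<^esub> letter j"
  have "?x \<in> clifford_relators n"
    using assms unfolding clifford_relators_def by blast
  from clifford_relator_zero[OF this] show ?thesis
    using assms(1,2)[THEN letter_in_free_algebra] by (simp add: clifford_gen_def)
qed

section \<open>Monomial matrices\<close>

text \<open>The flag is \<open>True\<close> for imaginary phases. With this choice the flag of a
  product is the exclusive or of the flags.\<close>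

definition phase_set :: "bool \<Rightarrow> complex set" where
  "phase_set t = (if t then {\<i>, - \<i>} else {1, - 1})"

text \<open>The phase \<open>u\<close> may vary from row to row; only its type is fixed. As
  \<open>n\<close> is arbitrary here, the bound on \<open>r XOR m\<close> is demanded explicitly; at
  row 0 it yields \<open>m < n\<close>.\<close>

definition xor_monomial :: "nat \<Rightarrow> nat \<Rightarrow> bool \<Rightarrow> complex mat \<Rightarrow> bool" where
  "xor_monomial n m t M \<longleftrightarrow> M \<in> carrier_mat n n \<and>
     (\<forall>r<n. r XOR m < n \<and> (\<exists>u\<in>phase_set t. \<forall>c<n. M $$ (r, c) = (if c = r XOR m then u else 0)))"

lemma phase_set_mult:
  "u \<in> phase_set t \<Longrightarrow> u' \<in> phase_set t' \<Longrightarrow> u * u' \<in> phase_set (t \<noteq> t')"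
  by (auto simp: phase_set_def split: if_splits)

lemma xor_monomialE:
  assumes "xor_monomial n m t M" and "r < n"
  obtains u where "u \<in> phase_set t" "r XOR m < n"
    "\<And>c. c < n \<Longrightarrow> M $$ (r, c) = (if c = r XOR m then u else 0)"
  using assms unfolding xor_monomial_def by blast

lemma xor_monomial_carrier: "xor_monomial n m t M \<Longrightarrow> M \<in> carrier_mat n n"
  by (simp add: xor_monomial_def)

lemma xor_monomial_one: "xor_monomial n 0 False (1\<^sub>m n)"
  by (auto simp: xor_monomial_def phase_set_def)

text \<open>In row \<open>r\<close> of the product only the summand \<open>i = r XOR m\<close>
  survives, so the masks compose by XOR and the phases multiply.\<close>

lemma xor_monomial_mult:
  assumes M: "xor_monomial n m t M" and N: "xor_monomial n m' t' N"
  shows "xor_monomial n (m XOR m') (t \<noteq> t') (M * N)"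
  unfolding xor_monomial_def
proof (intro conjI allI impI)
  note cM = xor_monomial_carrier[OF M] and cN = xor_monomial_carrier[OF N]
  show "M * N \<in> carrier_mat n n"
    using cM cN by simp
  fix r assume r: "r < n"
  obtain u where u: "u \<in> phase_set t" "r XOR m < n"
    "\<And>c. c < n \<Longrightarrow> M $$ (r, c) = (if c = r XOR m then u else 0)"
    using xor_monomialE[OF M r] by blast
  obtain u' where u': "u' \<in> phase_set t'" "(r XOR m) XOR m' < n"
    "\<And>c. c < n \<Longrightarrow> N $$ (r XOR m, c) = (if c = (r XOR m) XOR m' then u' else 0)"
    using xor_monomialE[OF N u(2)] by blast
  show "r XOR (m XOR m') < n"
    using u'(2) by (simp add: xor.assoc)
  show "\<exists>u\<in>phase_set (t \<noteq> t'). \<forall>c<n. (M * N) $$ (r, c) = (if c = r XOR (m XOR m') then u else 0)"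
  proof (intro bexI allI impI)
    show "u * u' \<in> phase_set (t \<noteq> t')"
      using phase_set_mult u(1) u'(1) .
    fix c assume c: "c < n"
    have "(M * N) $$ (r, c) = (\<Sum>i<n. M $$ (r, i) * N $$ (i, c))"
      using cM cN r c by (simp add: scalar_prod_def lessThan_atLeast0)
    also have "\<dots> = (\<Sum>i<n. if i = r XOR m then u * N $$ (r XOR m, c) else 0)"
      by (rule sum.cong) (auto simp: u(3))
    also have "\<dots> = u * N $$ (r XOR m, c)"
      using u(2) by simp
    finally show "(M * N) $$ (r, c) = (if c = r XOR (m XOR m') then u * u' else 0)"
      using u'(3)[OF c] by (simp add: xor.assoc)
  qed
qed

text \<open>Division by \<open>2 ^ b\<close> splits an index into the high bits seen by
  \<open>M\<close> and the low bits seen by \<open>N\<close>. Since \<open>m' < 2 ^ b\<close>, the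
  sum \<open>m * 2 ^ b + m'\<close> concatenates the two masks, and XOR acts on both parts
  separately.\<close>

lemma xor_monomial_kronecker:
  assumes M: "xor_monomial (2 ^ a) m t M" and N: "xor_monomial (2 ^ b) m' t' N" and m': "m' < 2 ^ b"
  shows "xor_monomial (2 ^ (a + b)) (m * 2 ^ b + m') (t \<noteq> t') (kronecker M N)"
  unfolding xor_monomial_def
proof (intro conjI allI impI)
  note cM = xor_monomial_carrier[OF M] and cN = xor_monomial_carrier[OF N]
  show K: "kronecker M N \<in> carrier_mat (2 ^ (a + b)) (2 ^ (a + b))"
    using cM cN by (simp add: kronecker_def power_add)
  fix r :: nat assume r: "r < 2 ^ (a + b)"
  let ?x = "r XOR (m * 2 ^ b + m')"
  have x_div: "?x div 2 ^ b = (r div 2 ^ b) XOR m"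
    using m' by (simp flip: drop_bit_eq_div add: drop_bit_xor) (simp add: drop_bit_eq_div)
  have x_mod: "?x mod 2 ^ b = (r mod 2 ^ b) XOR m'"
    using m' by (simp flip: take_bit_eq_mod add: take_bit_xor) (simp add: take_bit_eq_mod)
  have r1: "r div 2 ^ b < 2 ^ a"
    using r by (simp add: less_mult_imp_div_less power_add)
  have r2: "r mod 2 ^ b < 2 ^ b"
    by simp
  obtain u where u: "u \<in> phase_set t" "(r div 2 ^ b) XOR m < 2 ^ a"
    "\<And>c. c < 2 ^ a \<Longrightarrow> M $$ (r div 2 ^ b, c) = (if c = (r div 2 ^ b) XOR m then u else 0)"
    using xor_monomialE[OF M r1] by blast
  obtain u' where u': "u' \<in> phase_set t'" "(r mod 2 ^ b) XOR m' < 2 ^ b"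
    "\<And>c. c < 2 ^ b \<Longrightarrow> N $$ (r mod 2 ^ b, c) = (if c = (r mod 2 ^ b) XOR m' then u' else 0)"
    using xor_monomialE[OF N r2] by blast
  have "?x = ?x div 2 ^ b * 2 ^ b + ?x mod 2 ^ b"
    by (rule div_mult_mod_eq[symmetric])
  also have "\<dots> < Suc (?x div 2 ^ b) * 2 ^ b"
    by simp
  also have "\<dots> \<le> 2 ^ a * 2 ^ b"
    using u(2) unfolding x_div[symmetric] by (intro mult_le_mono1) simp
  finally show "?x < 2 ^ (a + b)"
    by (simp add: power_add)
  show "\<exists>u\<in>phase_set (t \<noteq> t'). \<forall>c<2 ^ (a + b). kronecker M N $$ (r, c) = (if c = ?x then u else 0)"
  proof (intro bexI allI impI)
    show "u * u' \<in> phase_set (t \<noteq> t')"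
      using phase_set_mult u(1) u'(1) .
    fix c :: nat assume c: "c < 2 ^ (a + b)"
    have c1: "c div 2 ^ b < 2 ^ a"
      using c by (simp add: less_mult_imp_div_less power_add)
    have "c = ?x \<longleftrightarrow> c div 2 ^ b = ?x div 2 ^ b \<and> c mod 2 ^ b = ?x mod 2 ^ b"
      by (metis div_mult_mod_eq)
    moreover have "kronecker M N $$ (r, c) =
        M $$ (r div 2 ^ b, c div 2 ^ b) * N $$ (r mod 2 ^ b, c mod 2 ^ b)"
      using r c cM cN by (simp add: kronecker_def power_add)
    ultimately show "kronecker M N $$ (r, c) = (if c = ?x then u * u' else 0)"
      unfolding x_div x_mod using u(3)[OF c1] u'(3)[of "c mod 2 ^ b"] by simp
  qed
qed

lemma xor_monomial_E1: "xor_monomial 2 0 True E1"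
  by (auto simp: xor_monomial_def phase_set_def E1_def mat_of_rows_list_def less_2_cases_iff)

lemma xor_monomial_E2: "xor_monomial 2 1 True E2"
  by (auto simp: xor_monomial_def phase_set_def E2_def mat_of_rows_list_def less_2_cases_iff)

lemma xor_monomial_B: "xor_monomial 2 1 True B"
  by (auto simp: xor_monomial_def phase_set_def B_def mat_of_rows_list_def less_2_cases_iff)

section \<open>Tensor powers and the images of the generators\<close>

lemma xor_monomial_kronecker_power_one:
  "xor_monomial (2 ^ a) 0 False (kronecker_power (1\<^sub>m 2) a)"
proof (induction a)
  case 0
  show ?case using xor_monomial_one[of 1] by simp
next
  case (Suc a)
  then show ?case
    using xor_monomial_kronecker[of 1 0 False "1\<^sub>m 2" a 0 False] xor_monomial_one[of 2] by simp
qed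

text \<open>Every factor \<open>B\<close> flips its own bit and contributes one imaginary phase, so
  the mask consists of \<open>a\<close> ones.\<close>

lemma xor_monomial_kronecker_power_B:
  "xor_monomial (2 ^ a) (2 ^ a - 1) (odd a) (kronecker_power B a)"
proof (induction a)
  case 0
  show ?case using xor_monomial_one[of 1] by simp
next
  case (Suc a)
  have "(2::nat) ^ a + (2 ^ a - 1) = 2 ^ Suc a - 1"
    by simp
  then show ?case
    using xor_monomial_kronecker[of 1 1 True B a "2 ^ a - 1" "odd a"] xor_monomial_B Suc by simp
qed

text \<open>\<open>\<rho>(e\<^sub>j)\<close> flips the lowest \<open>j div 2\<close> bits: one for each factor \<open>B\<close>, and one more for \<open>E2\<close>
  when \<open>j\<close> is even. Each of its \<open>(j + 1) div 2\<close> non-identity factors contributes a factor \<open>\<plusminus>\<i>\<close>.\<close>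

definition spin_mask :: "nat list \<Rightarrow> nat" where
  "spin_mask \<mu> = foldr (\<lambda>j m. (2 ^ (j div 2) - 1) XOR m) \<mu> 0"

definition spin_type :: "nat list \<Rightarrow> bool" where
  "spin_type \<mu> = foldr (\<lambda>j t. odd ((j + 1) div 2) \<noteq> t) \<mu> False"

lemma spin_gen_monomial:
  assumes "spin_rep k \<rho>" and "j \<in> {1..2 * k}"
  shows "xor_monomial (2 ^ k) (2 ^ (j div 2) - 1) (odd ((j + 1) div 2)) (\<rho> (clifford_gen (2 * k) j))"
proof -
  \<comment> \<open>\<open>q\<close> is the index of the pair \<open>2 * q - 1\<close>,
    \<open>2 * q\<close> that contains \<open>j\<close>; the factor \<open>E1\<close> or
    \<open>E2\<close> acts on bit \<open>q - 1\<close>.\<close>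
  define q where "q = (j + 1) div 2"
  have q: "q \<in> {1..k}" "j = 2 * q - 1 \<or> j = 2 * q" "k - q + 1 + (q - 1) = k"
    using assms(2) unfolding q_def by auto
  \<comment> \<open>Both cases are treated at once: \<open>m\<close> is 0 for \<open>E1\<close> and
    1 for \<open>E2\<close>. The imaginary factors are \<open>E\<close> and the \<open>q - 1\<close>
    copies of \<open>B\<close>, hence the type \<open>odd q\<close>.\<close>
  have mono: "xor_monomial (2 ^ k) (m * 2 ^ (q - 1) + (2 ^ (q - 1) - 1)) (odd q)
      (kronecker (kronecker (kronecker_power (1\<^sub>m 2) (k - q)) E) (kronecker_power B (q - 1)))"
    if E: "xor_monomial 2 m True E" and m: "m < 2" for m E
  proof -
    have "xor_monomial (2 ^ (k - q + 1)) m True (kronecker (kronecker_power (1\<^sub>m 2) (k - q)) E)"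
      using xor_monomial_kronecker[OF xor_monomial_kronecker_power_one[of "k - q"], where b = 1] E m by simp
    from xor_monomial_kronecker[OF this xor_monomial_kronecker_power_B[of "q - 1"]]
    show ?thesis
      using q by (simp add: q(3)[simplified])
  qed
  show ?thesis
  proof (cases "j = 2 * q")
    case True
    have "(2::nat) ^ (q - 1) + (2 ^ (q - 1) - 1) = 2 ^ q - 1"
      using q(1) by (cases q) auto
    moreover have "\<rho> (clifford_gen (2 * k) (2 * q)) =
        kronecker (kronecker (kronecker_power (1\<^sub>m 2) (k - q)) E2) (kronecker_power B (q - 1))"
      using assms(1) q(1) unfolding spin_rep_def by blast
    ultimately show ?thesis
      using mono[OF xor_monomial_E2] True by simp
  next
    case False
    then have j: "j = 2 * q - 1"
      using q(2) by blast
    then have "j div 2 = q - 1" "(j + 1) div 2 = q"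
      using q(1) by auto
    moreover have "\<rho> (clifford_gen (2 * k) (2 * q - 1)) =
        kronecker (kronecker (kronecker_power (1\<^sub>m 2) (k - q)) E1) (kronecker_power B (q - 1))"
      using assms(1) q(1) unfolding spin_rep_def by blast
    ultimately show ?thesis
      using mono[OF xor_monomial_E1] j by simp
  qed
qed

section \<open>Words in the generators\<close>

lemma xor_monomial_mask_less: "xor_monomial n m t M \<Longrightarrow> 0 < n \<Longrightarrow> m < n"
  by (metis xor.left_neutral xor_monomialE)

lemma phase_set_nonzero: "u \<in> phase_set t \<Longrightarrow> u \<noteq> 0"
  by (auto simp: phase_set_def split: if_splits)

text \<open>Row 0 has a nonzero entry, which differs from its negative. This lets a commutation sign
  be read off from a matrix identity.\<close>

lemma xor_monomial_neq_uminus: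
  assumes M: "xor_monomial n m t M" and "0 < n"
  shows "M \<noteq> - M"
proof
  assume eq: "M = - M"
  obtain u where u: "u \<in> phase_set t" "0 XOR m < n"
    "\<And>c. c < n \<Longrightarrow> M $$ (0, c) = (if c = 0 XOR m then u else 0)"
    using xor_monomialE[OF M \<open>0 < n\<close>] by blast
  have "M $$ (0, m) = - M $$ (0, m)"
    using arg_cong[OF eq, of "\<lambda>X. X $$ (0, m)"] xor_monomial_carrier[OF M] u(2) \<open>0 < n\<close> by simp
  then show False
    using u phase_set_nonzero[OF u(1)] by simp
qed

lemma clifford_word_simps:
  "clifford_word n [] = \<one>\<^bsub>clifford n\<^esub>"
  "clifford_word n (j # \<mu>) = clifford_gen n j \<otimes>\<^bsub>clifford n\<^esub> clifford_word n \<mu>"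
  by (simp_all add: clifford_word_def)

lemma spin_rep_hom:
  "spin_rep k \<rho> \<Longrightarrow> \<rho> \<in> Ring.ring_hom (clifford (2 * k)) (module_mat TYPE(complex) (2 ^ k) (2 ^ k))"
  by (simp add: spin_rep_def algebra_iso_def ring_iso_def)

lemma spin_word_Nil: "spin_rep k \<rho> \<Longrightarrow> \<rho> (clifford_word (2 * k) []) = 1\<^sub>m (2 ^ k)"
  using ring_hom_one[OF spin_rep_hom] by (simp add: clifford_word_simps module_mat_simps)

lemma spin_word_Cons:
  assumes "spin_rep k \<rho>" and "set (j # \<mu>) \<subseteq> {1..2 * k}"
  shows "\<rho> (clifford_word (2 * k) (j # \<mu>)) =
    \<rho> (clifford_gen (2 * k) j) * \<rho> (clifford_word (2 * k) \<mu>)"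
  using ring_hom_mult[OF spin_rep_hom[OF assms(1)] clifford_gen_closed clifford_word_closed] assms(2)
  by (simp add: clifford_word_simps module_mat_simps)

text \<open>Each generator changes mask and type as computed in \<open>spin_gen_monomial\<close>;
  the folds \<open>spin_mask\<close> and \<open>spin_type\<close> accumulate these changes.\<close>

lemma spin_word_monomial:
  assumes "spin_rep k \<rho>" and "set \<mu> \<subseteq> {1..2 * k}"
  shows "xor_monomial (2 ^ k) (spin_mask \<mu>) (spin_type \<mu>) (\<rho> (clifford_word (2 * k) \<mu>))"
  using assms(2)
proof (induction \<mu>)
  case Nil
  then show ?case
    using xor_monomial_one by (simp add: spin_mask_def spin_type_def spin_word_Nil[OF assms(1)])
next
  case (Cons j \<mu>)
  then have "xor_monomial (2 ^ k) ((2 ^ (j div 2) - 1) XOR spin_mask \<mu>)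
      (odd ((j + 1) div 2) \<noteq> spin_type \<mu>) (\<rho> (clifford_word (2 * k) (j # \<mu>)))"
    unfolding spin_word_Cons[OF assms(1) Cons.prems]
    by (intro xor_monomial_mult spin_gen_monomial assms(1)) auto
  then show ?case
    by (simp add: spin_mask_def spin_type_def)
qed

lemma spin_gen_anticommute:
  assumes "spin_rep k \<rho>" "j \<in> {1..2 * k}" "l \<in> {1..2 * k}" "j \<noteq> l"
  shows "\<rho> (clifford_gen (2 * k) j) * \<rho> (clifford_gen (2 * k) l) =
    - (\<rho> (clifford_gen (2 * k) l) * \<rho> (clifford_gen (2 * k) j))" (is "?G * ?H = - (?H * ?G)")
proof -
  interpret ring "clifford (2 * k)" by (rule clifford_ring)
  note hom = spin_rep_hom[OF assms(1)]
  let ?g = "clifford_gen (2 * k) j" and ?h = "clifford_gen (2 * k) l"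
  have gh: "?g \<in> carrier (clifford (2 * k))" "?h \<in> carrier (clifford (2 * k))"
    using assms clifford_gen_closed by blast+
  have cG: "?G \<in> carrier_mat (2 ^ k) (2 ^ k)" and cH: "?H \<in> carrier_mat (2 ^ k) (2 ^ k)"
    using gh[THEN ring_hom_closed[OF hom]] by (simp_all add: module_mat_simps)
  have Z: "\<rho> \<zero>\<^bsub>clifford (2 * k)\<^esub> \<in> carrier_mat (2 ^ k) (2 ^ k)"
    using ring_hom_closed[OF hom] by (simp add: module_mat_simps)
  \<comment> \<open>That \<open>\<rho>\<close> sends zero to the zero matrix comes from
    \<open>0 + 0 = 0\<close>: a matrix equal to its own double has only zero entries.\<close>
  have "\<rho> \<zero>\<^bsub>clifford (2 * k)\<^esub> + \<rho> \<zero>\<^bsub>clifford (2 * k)\<^esub> = \<rho> \<zero>\<^bsub>clifford (2 * k)\<^esub>"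
    using ring_hom_add[OF hom zero_closed zero_closed] by (simp add: module_mat_simps)
  then have zero: "\<rho> \<zero>\<^bsub>clifford (2 * k)\<^esub> $$ (r, c) = 0" if "r < 2 ^ k" "c < 2 ^ k" for r c
  proof -
    have "(\<rho> \<zero>\<^bsub>clifford (2 * k)\<^esub> + \<rho> \<zero>\<^bsub>clifford (2 * k)\<^esub>) $$ (r, c) = \<rho> \<zero>\<^bsub>clifford (2 * k)\<^esub> $$ (r, c)"
      using \<open>_ + _ = _\<close> by simp
    then show ?thesis
      using Z that by simp
  qed
  have sum: "?G * ?H + ?H * ?G = \<rho> \<zero>\<^bsub>clifford (2 * k)\<^esub>"
    using ring_hom_add[OF hom, of "?g \<otimes>\<^bsub>clifford (2 * k)\<^esub> ?h" "?h \<otimes>\<^bsub>clifford (2 * k)\<^esub> ?g"]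
      clifford_gen_anticommute[OF assms(2-4)] gh
    by (simp add: ring_hom_mult[OF hom] module_mat_simps)
  show ?thesis
  proof (rule eq_matI)
    fix r c assume rc: "r < dim_row (- (?H * ?G))" "c < dim_col (- (?H * ?G))"
    then have "r < 2 ^ k" "c < 2 ^ k"
      using cG cH by auto
    then have "(?G * ?H + ?H * ?G) $$ (r, c) = 0"
      using zero sum by simp
    then show "(?G * ?H) $$ (r, c) = (- (?H * ?G)) $$ (r, c)"
      using rc by (simp add: eq_neg_iff_add_eq_0 del: index_mult_mat)
  qed (use cG cH in simp_all)
qed

text \<open>Passing the generator \<open>j\<close> through a letter costs a sign unless the letter
  is \<open>j\<close> itself, so the exponent counts the other letters.\<close>

lemma spin_gen_word_commute:
  assumes "spin_rep k \<rho>" "j \<in> {1..2 * k}" "set \<mu> \<subseteq> {1..2 * k}"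
  shows "\<rho> (clifford_gen (2 * k) j) * \<rho> (clifford_word (2 * k) \<mu>) =
    (- 1) ^ length (filter (\<lambda>i. i \<noteq> j) \<mu>) \<cdot>\<^sub>m
      (\<rho> (clifford_word (2 * k) \<mu>) * \<rho> (clifford_gen (2 * k) j))"
  using assms(3)
proof (induction \<mu>)
  case Nil
  have "\<rho> (clifford_gen (2 * k) j) \<in> carrier_mat (2 ^ k) (2 ^ k)"
    using spin_gen_monomial[OF assms(1,2)] xor_monomial_carrier by blast
  then show ?case
    by (auto simp: spin_word_Nil[OF assms(1)] intro!: eq_matI)
next
  case (Cons i \<mu>)
  let ?G = "\<rho> (clifford_gen (2 * k) j)" and ?H = "\<rho> (clifford_gen (2 * k) i)"
    and ?W = "\<rho> (clifford_word (2 * k) \<mu>)" and ?s = "(- 1) ^ length (filter (\<lambda>i. i \<noteq> j) \<mu>) :: complex"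
  have cG: "?G \<in> carrier_mat (2 ^ k) (2 ^ k)" and cH: "?H \<in> carrier_mat (2 ^ k) (2 ^ k)"
    and cW: "?W \<in> carrier_mat (2 ^ k) (2 ^ k)"
    using spin_gen_monomial[OF assms(1)] spin_word_monomial[OF assms(1)] assms(2) Cons.prems
      xor_monomial_carrier by (metis insert_subset list.simps(15))+
  have IH: "?G * ?W = ?s \<cdot>\<^sub>m (?W * ?G)"
    using Cons by simp
  have move: "?H * (?G * ?W) = ?s \<cdot>\<^sub>m (?H * ?W * ?G)"
    unfolding IH using cG cH cW by (simp add: mult_smult_distrib[OF cH mult_carrier_mat[OF cW cG]])
  have swap: "?G * (?H * ?W) = ?G * ?H * ?W"
    using cG cH cW by simp
  show ?case
  proof (cases "i = j")
    case True
    then show ?thesis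
      unfolding spin_word_Cons[OF assms(1) Cons.prems] using move by simp
  next
    case False
    have "?G * (?H * ?W) = - (?H * ?G) * ?W"
      unfolding swap using spin_gen_anticommute[OF assms(1,2), of i] False Cons.prems by simp
    also have "\<dots> = - (?H * (?G * ?W))"
      using cG cH cW by simp
    also have "\<dots> = (- ?s) \<cdot>\<^sub>m (?H * ?W * ?G)"
      unfolding move by (rule eq_matI) simp_all
    finally show ?thesis
      unfolding spin_word_Cons[OF assms(1) Cons.prems] using False by simp
  qed
qed

text \<open>A distinct list contains \<open>j\<close> at most once, so the filter removes one
  element or none.\<close>

lemma even_length_filter_neq:
  "distinct xs \<Longrightarrow>
    even (length (filter (\<lambda>i. i \<noteq> j) xs)) \<longleftrightarrow> (even (length xs) \<longleftrightarrow> j \<notin> set xs)"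
  by (induction xs) auto

text \<open>Conjugation by \<open>e\<^sub>j\<close> multiplies \<open>e\<^sub>\<mu>\<close> by the sign with exponent \<open>|\<mu>| - [j \<in> \<mu>]\<close>. So equal words have
  either equal or complementary supports, and in the latter case lengths of different parity,
  although they add up to \<open>2 * k\<close>.\<close>

lemma spin_word_inj:
  assumes "spin_rep k \<rho>"
  shows "inj_on (\<lambda>\<mu>. \<rho> (clifford_word (2 * k) \<mu>)) (increasing_seqs (2 * k))"
proof (rule inj_onI)
  fix \<mu> \<eta> assume mu: "\<mu> \<in> increasing_seqs (2 * k)" and eta: "\<eta> \<in> increasing_seqs (2 * k)"
    and eq: "\<rho> (clifford_word (2 * k) \<mu>) = \<rho> (clifford_word (2 * k) \<eta>)"
  have sets: "set \<mu> \<subseteq> {1..2 * k}" "set \<eta> \<subseteq> {1..2 * k}"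
    and sorted: "sorted_wrt (<) \<mu>" "sorted_wrt (<) \<eta>"
    using mu eta by (auto simp: increasing_seqs_def)
  have dist: "distinct \<mu>" "distinct \<eta>"
    using sorted strict_sorted_iff by blast+
  let ?f = "\<lambda>j \<mu>. length (filter (\<lambda>i. i \<noteq> j) \<mu>)"
  have par: "even (?f j \<mu>) = even (?f j \<eta>)" if j: "j \<in> {1..2 * k}" for j
  proof (rule ccontr)
    assume neq: "even (?f j \<mu>) \<noteq> even (?f j \<eta>)"
    let ?X = "\<rho> (clifford_word (2 * k) \<eta>) * \<rho> (clifford_gen (2 * k) j)"
    have "(- 1) ^ ?f j \<mu> \<cdot>\<^sub>m ?X = (- 1) ^ ?f j \<eta> \<cdot>\<^sub>m ?X"
      using spin_gen_word_commute[OF assms j sets(1)] spin_gen_word_commute[OF assms j sets(2)] eq by simp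
    then have entries: "((- 1) ^ ?f j \<mu> \<cdot>\<^sub>m ?X) $$ (r, c) = ((- 1) ^ ?f j \<eta> \<cdot>\<^sub>m ?X) $$ (r, c)" for r c
      by simp
    \<comment> \<open>The two signs are opposite, so the common product would equal its own
      negative, which is impossible for a monomial matrix.\<close>
    have "?X = - ?X"
    proof (rule eq_matI)
      fix r c assume "r < dim_row (- ?X)" "c < dim_col (- ?X)"
      then show "?X $$ (r, c) = (- ?X) $$ (r, c)"
        using neq entries[of r c] by (cases "even (?f j \<mu>)") (simp_all del: index_mult_mat(1))
    qed simp_all
    moreover have "?X \<noteq> - ?X"
      by (rule xor_monomial_neq_uminus[OF xor_monomial_mult[OF spin_word_monomial[OF assms sets(2)]
        spin_gen_monomial[OF assms j]]]) simp
    ultimately show False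
      by contradiction
  qed
  have mem: "(j \<in> set \<mu> \<longleftrightarrow> j \<in> set \<eta>) \<longleftrightarrow> even (length \<mu> + length \<eta>)" if "j \<in> {1..2 * k}" for j
    using par[OF that] unfolding even_length_filter_neq[OF dist(1)] even_length_filter_neq[OF dist(2)]
    by auto
  have "even (length \<mu> + length \<eta>)"
  proof (rule ccontr)
    assume odd: "odd (length \<mu> + length \<eta>)"
    then have "set \<mu> \<inter> set \<eta> = {}" "set \<mu> \<union> set \<eta> = {1..2 * k}"
      using mem sets by blast+
    then have "card (set \<mu>) + card (set \<eta>) = card {1..2 * k}"
      by (metis List.finite_set card_Un_disjoint)
    then have "length \<mu> + length \<eta> = 2 * k"
      using dist by (simp add: distinct_card)
    then show False
      using odd by simp
  qed
  then have "set \<mu> = set \<eta>"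
    using mem sets by blast
  then show "\<mu> = \<eta>"
    using sorted by (simp add: strict_sorted_equal)
qed

section \<open>Counting increasing sequences\<close>

lemma increasing_seqs_0: "increasing_seqs 0 = {[]}"
  by (auto simp: increasing_seqs_def)

text \<open>The letter \<open>Suc n\<close> can occur only in the last place, so the sequences split
  by whether they end in it.\<close>

lemma increasing_seqs_Suc:
  "increasing_seqs (Suc n) = increasing_seqs n \<union> (\<lambda>\<mu>. \<mu> @ [Suc n]) ` increasing_seqs n"
proof (intro Set.set_eqI iffI)
  fix \<mu> assume mu: "\<mu> \<in> increasing_seqs (Suc n)"
  show "\<mu> \<in> increasing_seqs n \<union> (\<lambda>\<mu>. \<mu> @ [Suc n]) ` increasing_seqs n"
  proof (cases \<mu> rule: rev_cases)
    case Nil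
    then show ?thesis by (simp add: increasing_seqs_def)
  next
    case (snoc \<nu> j)
    have nu: "sorted_wrt (<) \<nu>" "\<forall>i\<in>set \<nu>. i < j" "set \<nu> \<subseteq> {1..Suc n}" "1 \<le> j" "j \<le> Suc n"
      using mu snoc by (auto simp: increasing_seqs_def sorted_wrt_append)
    then have "set \<nu> \<subseteq> {1..n}"
      by (auto dest!: bspec)
    then have "\<nu> \<in> increasing_seqs n"
      using nu by (simp add: increasing_seqs_def)
    then show ?thesis
      using nu snoc by (cases "j = Suc n") (auto simp: increasing_seqs_def sorted_wrt_append)
  qed
next
  fix \<mu> assume "\<mu> \<in> increasing_seqs n \<union> (\<lambda>\<mu>. \<mu> @ [Suc n]) ` increasing_seqs n"
  then show "\<mu> \<in> increasing_seqs (Suc n)"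
    by (fastforce simp: increasing_seqs_def sorted_wrt_append)
qed

lemma finite_increasing_seqs: "finite (increasing_seqs n)"
  by (induction n) (simp_all add: increasing_seqs_0 increasing_seqs_Suc)

lemma spin_mask_snoc: "spin_mask (\<mu> @ [j]) = spin_mask \<mu> XOR (2 ^ (j div 2) - 1)"
  by (induction \<mu>) (simp_all add: spin_mask_def xor.assoc)

lemma spin_type_snoc: "spin_type (\<mu> @ [j]) = (spin_type \<mu> \<noteq> odd ((j + 1) div 2))"
  by (induction \<mu>) (auto simp: spin_type_def)

lemma xor_eq_iff_eq_xor: "(a::nat) XOR x = b \<longleftrightarrow> a = b XOR x"
  by (auto simp: xor.assoc)

definition key_fibre :: "nat \<Rightarrow> nat \<Rightarrow> bool \<Rightarrow> nat list set" where
  "key_fibre n m t = {\<mu> \<in> increasing_seqs n. spin_mask \<mu> = m \<and> spin_type \<mu> = t}"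

text \<open>Appending a letter changes mask, type and length parity together, so the three obey one
  joint recursion.\<close>

definition parity_count :: "nat \<Rightarrow> nat \<Rightarrow> bool \<Rightarrow> bool \<Rightarrow> nat" where
  "parity_count n m t e = card {\<mu> \<in> key_fibre n m t. even (length \<mu>) = e}"

lemma finite_key_fibre: "finite (key_fibre n m t)"
  by (simp add: key_fibre_def finite_increasing_seqs)

lemma card_key_fibre: "card (key_fibre n m t) = parity_count n m t True + parity_count n m t False"
proof -
  have "key_fibre n m t =
      {\<mu> \<in> key_fibre n m t. even (length \<mu>) = True} \<union> {\<mu> \<in> key_fibre n m t. even (length \<mu>) = False}"
    by auto
  then show ?thesis
    unfolding parity_count_def
    by (subst card_Un_disjoint[symmetric]) (auto simp: finite_key_fibre)
qed

lemma parity_count_0: "parity_count 0 m t e = (if m = 0 \<and> \<not> t \<and> e then 1 else 0)"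
proof -
  have "{\<mu> \<in> key_fibre 0 m t. even (length \<mu>) = e} = (if m = 0 \<and> \<not> t \<and> e then {[]} else {})"
    by (auto simp: key_fibre_def increasing_seqs_0 spin_mask_def spin_type_def)
  then show ?thesis
    by (simp add: parity_count_def)
qed

text \<open>The second summand counts the sequences ending in \<open>Suc n\<close> after that letter
  is removed. XOR is an involution, so the required mask and type of the rest can be solved
  for.\<close>

lemma parity_count_Suc:
  "parity_count (Suc n) m t e = parity_count n m t e +
     parity_count n (m XOR (2 ^ (Suc n div 2) - 1)) (t \<noteq> odd (Suc (Suc n) div 2)) (\<not> e)"
proof -
  let ?x = "2 ^ (Suc n div 2) - 1 :: nat"
  let ?A = "{\<mu> \<in> key_fibre n m t. even (length \<mu>) = e}"
  let ?B = "{\<mu> \<in> key_fibre n (m XOR ?x) (t \<noteq> odd (Suc (Suc n) div 2)). even (length \<mu>) = (\<not> e)}"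
  have "{\<mu> \<in> key_fibre (Suc n) m t. even (length \<mu>) = e} = ?A \<union> (\<lambda>\<mu>. \<mu> @ [Suc n]) ` ?B"
  proof -
    have snoc: "\<mu> @ [Suc n] \<in> {\<mu>. spin_mask \<mu> = m \<and> spin_type \<mu> = t \<and> even (length \<mu>) = e} \<longleftrightarrow>
        spin_mask \<mu> = m XOR ?x \<and> spin_type \<mu> = (t \<noteq> odd (Suc (Suc n) div 2)) \<and>
        even (length \<mu>) = (\<not> e)" for \<mu>
      unfolding mem_Collect_eq spin_mask_snoc spin_type_snoc xor_eq_iff_eq_xor[of _ _ m] by auto
    show ?thesis
      using snoc unfolding key_fibre_def increasing_seqs_Suc by blast
  qed
  moreover have "?A \<inter> (\<lambda>\<mu>. \<mu> @ [Suc n]) ` ?B = {}"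
    by (auto simp: key_fibre_def increasing_seqs_def)
  moreover have "finite ?A" "finite ?B"
    by (simp_all add: finite_key_fibre)
  moreover have "inj_on (\<lambda>\<mu>. \<mu> @ [Suc n]) ?B"
    by (simp add: inj_on_def)
  ultimately show ?thesis
    unfolding parity_count_def by (simp add: card_Un_disjoint card_image)
qed

section \<open>Solving the recursion two letters at a time\<close>

lemma drop_bit_eq_0_iff_less: "drop_bit k (m::nat) = 0 \<longleftrightarrow> m < 2 ^ k"
  by (simp add: drop_bit_eq_div div_eq_0_iff)

lemma xor_one_eq_0_iff: "(d::nat) XOR 1 = 0 \<longleftrightarrow> d = 1"
  using xor_eq_iff_eq_xor[of d 1 0] by simp

text \<open>The sequences \<open>[]\<close>, \<open>[1]\<close>, \<open>[2]\<close>,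
  \<open>[1, 2]\<close> realise the four pairs of mask and type once each, and the length is even
  exactly for the real type. So the parities are not balanced at \<open>k = 1\<close>.\<close>

lemma parity_count_2: "parity_count 2 m t e = (if m < 2 \<and> e \<noteq> t then 1 else 0)"
proof -
  have "parity_count (Suc (Suc 0)) m t e = (if (m = 0 \<or> m = 1) \<and> e \<noteq> t then 1 else 0)"
    using xor_one_eq_0_iff[of m] by (auto simp: parity_count_Suc parity_count_0)
  then show ?thesis
    by (simp add: less_2_cases_iff numeral_2_eq_2[symmetric])
qed

text \<open>The summands belong in order to neither new letter, \<open>2 * k + 1\<close> alone,
  \<open>2 * k + 2\<close> alone, and both. The two letters shift the type equally, so together they
  leave it unchanged.\<close>

lemma parity_count_double_Suc:
  "parity_count (2 * Suc k) m t e =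
     parity_count (2 * k) m t e +
     parity_count (2 * k) (m XOR (2 ^ k - 1)) (t \<noteq> even k) (\<not> e) +
     (parity_count (2 * k) (m XOR (2 ^ Suc k - 1)) (t \<noteq> even k) (\<not> e) +
      parity_count (2 * k) ((m XOR (2 ^ Suc k - 1)) XOR (2 ^ k - 1)) t e)"
proof -
  have "2 * Suc k = Suc (Suc (2 * k))"
    by simp
  moreover have "Suc (2 * k) div 2 = k" "Suc (Suc (2 * k)) div 2 = Suc k" "Suc (Suc (Suc (2 * k))) div 2 = Suc k"
    by simp_all
  moreover have "((t \<noteq> odd (Suc k)) \<noteq> odd (Suc k)) = t" "odd (Suc k) = even k"
    by auto
  ultimately show ?thesis
    by (simp only: parity_count_Suc not_not)
qed

text \<open>The letter \<open>2 * k + 1\<close> leaves the bits from \<open>k\<close> upwards alone,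
  while \<open>2 * k + 2\<close> flips bit \<open>k\<close>. For \<open>m < 2 ^ Suc k\<close> either
  the first two or the last two summands of the recursion survive, each doubling the count.\<close>

lemma parity_count_even:
  assumes "k \<ge> 2"
  shows "parity_count (2 * k) m t e = (if m < 2 ^ k then 2 ^ (k - 2) else 0)"
proof -
  have drops: "drop_bit k (m XOR (2 ^ k - 1)) = drop_bit k m"
    "drop_bit k (m XOR (2 ^ Suc k - 1)) = drop_bit k m XOR 1"
    "drop_bit k ((m XOR (2 ^ Suc k - 1)) XOR (2 ^ k - 1)) = drop_bit k m XOR 1" for k and m :: nat
  proof -
    have "drop_bit k (2 ^ k - 1 :: nat) = 0"
      by (simp add: drop_bit_eq_0_iff_less)
    moreover have "drop_bit k (2 ^ Suc k - 1 :: nat) = 1"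
      using zero_less_power[of "2::nat" k, OF zero_less_numeral] unfolding drop_bit_eq_div power_Suc
      by (intro div_nat_eqI; simp only: mult_Suc_right mult_1_right One_nat_def mult_0_right; linarith)
    ultimately show "drop_bit k (m XOR (2 ^ k - 1)) = drop_bit k m"
      "drop_bit k (m XOR (2 ^ Suc k - 1)) = drop_bit k m XOR 1"
      "drop_bit k ((m XOR (2 ^ Suc k - 1)) XOR (2 ^ k - 1)) = drop_bit k m XOR 1"
      by (simp_all only: drop_bit_xor xor.right_neutral)
  qed
  have less: "m < 2 ^ Suc k \<longleftrightarrow> drop_bit k m = 0 \<or> drop_bit k m = 1" for k and m :: nat
  proof -
    have "m < 2 ^ Suc k \<longleftrightarrow> drop_bit k m < 2"
      by (simp add: drop_bit_eq_div div_less_iff_less_mult)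
    then show ?thesis by auto
  qed
  show ?thesis
    using assms
  proof (induction k arbitrary: m t e rule: nat_induct_at_least)
    case base
    \<comment> \<open>The letters 3 and 4 keep the type and each flips the parity. The two surviving
      summands thus have opposite parities and the same type, and exactly one of them is 1; here the
      balance arises.\<close>
    have two: "parity_count (2 * 1) m t e = (if drop_bit 1 m = 0 \<and> e \<noteq> t then 1 else 0)" for m t e
      using parity_count_2 by (simp add: drop_bit_eq_0_iff_less[of 1, simplified])
    have "parity_count (2 * Suc 1) m t e = (if m < 2 ^ Suc 1 then 1 else 0)"
      unfolding parity_count_double_Suc two drops less xor_one_eq_0_iff by auto
    then show ?case
      unfolding Suc_1 by simp
  next
    case (Suc k)
    have IH: "parity_count (2 * k) m t e = (if drop_bit k m = 0 then 2 ^ (k - 2) else 0)" for m t e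
      using Suc.IH by (simp add: drop_bit_eq_0_iff_less)
    \<comment> \<open>By \<open>k >= 2\<close> the truncated subtraction is a true one.\<close>
    have "(2::nat) ^ (Suc k - 2) = 2 * 2 ^ (k - 2)"
      using Suc.hyps by (metis Suc_diff_le power_Suc)
    then show ?case
      unfolding parity_count_double_Suc IH drops less xor_one_eq_0_iff by auto
  qed
qed

text \<open>The two parities are added. The case \<open>k = 1\<close> is separate: one parity
  contributes 1 and the other 0.\<close>

lemma card_key_fibre_even:
  assumes "k \<ge> 1"
  shows "card (key_fibre (2 * k) m t) = (if m < 2 ^ k then 2 ^ (k - 1) else 0)"
proof (cases "k = 1")
  case True
  then show ?thesis
    by (simp add: card_key_fibre parity_count_2)
next
  case False
  then have k: "k \<ge> 2"
    using assms by simp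
  have "Suc (k - 2) = k - 1"
    using k by simp
  then have "(2::nat) ^ (k - 1) = 2 * 2 ^ (k - 2)"
    by (metis power_Suc)
  then show ?thesis
    using parity_count_even[OF k] by (simp add: card_key_fibre)
qed

section \<open>The action on 2-torsion points\<close>

definition gauss_ints :: "complex set" where
  "gauss_ints = {z. Re z \<in> \<int> \<and> Im z \<in> \<int>}"

lemma gauss_ints_closed:
  "0 \<in> gauss_ints"
  "x \<in> gauss_ints \<Longrightarrow> y \<in> gauss_ints \<Longrightarrow> x + y \<in> gauss_ints"
  "x \<in> gauss_ints \<Longrightarrow> - x \<in> gauss_ints"
  "x \<in> gauss_ints \<Longrightarrow> y \<in> gauss_ints \<Longrightarrow> x * y \<in> gauss_ints"
  by (auto simp: gauss_ints_def)

lemma phase_set_subset_gauss_ints: "phase_set t \<subseteq> gauss_ints"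
  by (auto simp: phase_set_def gauss_ints_def)

lemma mem_gauss_lattice:
  "v \<in> gauss_lattice n \<longleftrightarrow> v \<in> carrier_vec n \<and> (\<forall>i<n. v $ i \<in> gauss_ints)"
  by (simp add: gauss_lattice_def gauss_ints_def)

lemma abelian_group_module_vec: "abelian_group (module_vec TYPE('a::ring_1) n)"
proof (rule abelian_groupI)
  fix v assume "v \<in> carrier (module_vec TYPE('a) n)"
  then show "\<exists>w\<in>carrier (module_vec TYPE('a) n).
      w \<oplus>\<^bsub>module_vec TYPE('a) n\<^esub> v = \<zero>\<^bsub>module_vec TYPE('a) n\<^esub>"
    by (intro bexI[of _ "- v"]) (auto simp: module_vec_simps)
qed (auto simp: module_vec_simps intro: comm_add_vec)

lemma gauss_lattice_subgroup: "abelian_subgroup (gauss_lattice n) (module_vec TYPE(complex) n)"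
proof (rule abelian_subgroupI3)
  interpret abelian_group "module_vec TYPE(complex) n" by (rule abelian_group_module_vec)
  show "abelian_group (module_vec TYPE(complex) n)"
    by (rule abelian_group_module_vec)
  show "additive_subgroup (gauss_lattice n) (module_vec TYPE(complex) n)"
  proof (rule additive_subgroupI, rule add.subgroupI)
    show "gauss_lattice n \<noteq> {}"
      using mem_gauss_lattice[of "0\<^sub>v n" n] gauss_ints_closed(1) by auto
  next
    fix v assume v: "v \<in> gauss_lattice n"
    then have "- v \<in> gauss_lattice n"
      by (auto simp: mem_gauss_lattice gauss_ints_closed)
    moreover have "\<ominus>\<^bsub>module_vec TYPE(complex) n\<^esub> v = - v"
      using v by (intro minus_equality) (auto simp: mem_gauss_lattice module_vec_simps)
    ultimately show "\<ominus>\<^bsub>module_vec TYPE(complex) n\<^esub> v \<in> gauss_lattice n"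
      by simp
  qed (auto simp: module_vec_simps mem_gauss_lattice gauss_ints_closed)
qed

abbreviation gauss_coset :: "nat \<Rightarrow> complex vec \<Rightarrow> complex vec set" where
  "gauss_coset n v \<equiv> gauss_lattice n +>\<^bsub>module_vec TYPE(complex) n\<^esub> v"

lemma mem_gauss_coset: "x \<in> gauss_coset n v \<longleftrightarrow> (\<exists>l\<in>gauss_lattice n. x = l + v)"
  by (auto simp: a_r_coset_def' module_vec_simps)

lemma gauss_coset_eqI:
  assumes "x \<in> gauss_coset n v" and "v \<in> carrier_vec n"
  shows "gauss_coset n x = gauss_coset n v"
proof -
  interpret abelian_subgroup "gauss_lattice n" "module_vec TYPE(complex) n"
    by (rule gauss_lattice_subgroup)
  show ?thesis
    using a_repr_independence[OF assms(1)] assms(2) a_subgroup by (simp add: module_vec_simps)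
qed

lemma gauss_coset_eq_iff:
  assumes "v \<in> carrier_vec n" and "w \<in> carrier_vec n"
  shows "gauss_coset n v = gauss_coset n w \<longleftrightarrow> v - w \<in> gauss_lattice n"
proof -
  interpret abelian_subgroup "gauss_lattice n" "module_vec TYPE(complex) n"
    by (rule gauss_lattice_subgroup)
  have "gauss_coset n v = gauss_coset n w \<longleftrightarrow> v \<in> gauss_coset n w"
    using gauss_coset_eqI[OF _ assms(2)] a_rcos_self[of v] assms by (auto simp: module_vec_simps)
  also have "\<dots> \<longleftrightarrow> v - w \<in> gauss_lattice n"
  proof
    assume "v \<in> gauss_coset n w"
    then obtain l where l: "l \<in> gauss_lattice n" "v = l + w"
      by (auto simp: mem_gauss_coset)
    then have "v - w = l"
      using assms by (auto simp: mem_gauss_lattice)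
    then show "v - w \<in> gauss_lattice n"
      using l by simp
  next
    assume "v - w \<in> gauss_lattice n"
    moreover have "v = (v - w) + w"
      using assms by auto
    ultimately show "v \<in> gauss_coset n w"
      unfolding mem_gauss_coset by blast
  qed
  finally show ?thesis .
qed

text \<open>Twice the coset of \<open>v\<close> is the coset of \<open>v + v\<close>, which is
  trivial exactly when \<open>v + v\<close> lies in the lattice.\<close>

lemma mem_two_torsion:
  "X \<in> two_torsion k \<longleftrightarrow>
    (\<exists>v\<in>carrier_vec (2 ^ k). X = gauss_coset (2 ^ k) v \<and> v + v \<in> gauss_lattice (2 ^ k))"
proof -
  interpret abelian_subgroup "gauss_lattice (2 ^ k)" "module_vec TYPE(complex) (2 ^ k)"
    by (rule gauss_lattice_subgroup)
  have const: "gauss_coset (2 ^ k) w = gauss_lattice (2 ^ k) \<longleftrightarrow> w \<in> gauss_lattice (2 ^ k)"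
    if "w \<in> carrier_vec (2 ^ k)" for w
    using a_rcos_const a_rcos_self[of w] that by (auto simp: module_vec_simps)
  have double: "gauss_coset (2 ^ k) v <+>\<^bsub>module_vec TYPE(complex) (2 ^ k)\<^esub> gauss_coset (2 ^ k) v =
      gauss_lattice (2 ^ k) \<longleftrightarrow> v + v \<in> gauss_lattice (2 ^ k)" if "v \<in> carrier_vec (2 ^ k)" for v
    using a_rcos_sum[of v v] const[of "v + v"] that by (simp add: module_vec_simps)
  have "X \<in> two_torsion k \<longleftrightarrow> (\<exists>v\<in>carrier_vec (2 ^ k). X = gauss_coset (2 ^ k) v \<and>
      gauss_coset (2 ^ k) v <+>\<^bsub>module_vec TYPE(complex) (2 ^ k)\<^esub> gauss_coset (2 ^ k) v =
      gauss_lattice (2 ^ k))"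
    unfolding two_torsion_def spin_torus_def A_FactGroup_def' A_RCOSETS_def'
    by (auto simp only: module_vec_simps mem_Collect_eq partial_object.simps monoid.simps)
  then show ?thesis
    by (simp add: double cong: bex_cong)
qed

text \<open>The union in \<open>torus_act\<close> runs over all representatives. Since
  \<open>M\<close> preserves the lattice, each contributes the same coset and the union
  collapses.\<close>

lemma torus_act_coset:
  assumes M: "M \<in> carrier_mat (2 ^ k) (2 ^ k)" and v: "v \<in> carrier_vec (2 ^ k)"
    and lattice: "\<And>l. l \<in> gauss_lattice (2 ^ k) \<Longrightarrow> M *\<^sub>v l \<in> gauss_lattice (2 ^ k)"
  shows "torus_act k M (gauss_coset (2 ^ k) v) = gauss_coset (2 ^ k) (M *\<^sub>v v)"
proof -
  interpret abelian_subgroup "gauss_lattice (2 ^ k)" "module_vec TYPE(complex) (2 ^ k)"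
    by (rule gauss_lattice_subgroup)
  have "gauss_coset (2 ^ k) (M *\<^sub>v x) = gauss_coset (2 ^ k) (M *\<^sub>v v)"
    if x: "x \<in> gauss_coset (2 ^ k) v" for x
  proof (rule gauss_coset_eqI)
    obtain l where l: "l \<in> gauss_lattice (2 ^ k)" "x = l + v"
      using x by (auto simp: mem_gauss_coset)
    then have "M *\<^sub>v x = M *\<^sub>v l + M *\<^sub>v v"
      using M v by (auto simp: mem_gauss_lattice intro!: mult_add_distrib_mat_vec)
    then show "M *\<^sub>v x \<in> gauss_coset (2 ^ k) (M *\<^sub>v v)"
      using lattice[OF l(1)] unfolding mem_gauss_coset by blast
  qed (use M v in auto)
  moreover have "v \<in> gauss_coset (2 ^ k) v"
    using a_rcos_self[of v] v by (simp add: module_vec_simps)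
  ultimately show ?thesis
    unfolding torus_act_def by blast
qed

text \<open>The phase is obtained before the vector, so one \<open>u\<close> serves all
  \<open>v\<close> in the given row.\<close>

lemma xor_monomial_mult_vec:
  assumes "xor_monomial n m t M" and "r < n"
  obtains u where "u \<in> phase_set t" "r XOR m < n"
    "\<And>v. v \<in> carrier_vec n \<Longrightarrow> (M *\<^sub>v v) $ r = u * v $ (r XOR m)"
proof -
  obtain u where u: "u \<in> phase_set t" "r XOR m < n"
    "\<And>c. c < n \<Longrightarrow> M $$ (r, c) = (if c = r XOR m then u else 0)"
    using xor_monomialE[OF assms] by blast
  have "(M *\<^sub>v v) $ r = u * v $ (r XOR m)" if v: "v \<in> carrier_vec n" for v
  proof -
    have "(M *\<^sub>v v) $ r = (\<Sum>c<n. M $$ (r, c) * v $ c)"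
      using xor_monomial_carrier[OF assms(1)] v assms(2) by (simp add: scalar_prod_def lessThan_atLeast0)
    also have "\<dots> = (\<Sum>c<n. if c = r XOR m then u * v $ (r XOR m) else 0)"
      by (rule sum.cong) (auto simp: u(3))
    finally show ?thesis
      using u(2) by simp
  qed
  then show ?thesis
    using that u by blast
qed

lemma xor_monomial_gauss_lattice:
  assumes "xor_monomial n m t M" and "l \<in> gauss_lattice n"
  shows "M *\<^sub>v l \<in> gauss_lattice n"
proof -
  have "(M *\<^sub>v l) $ r \<in> gauss_ints" if r: "r < n" for r
  proof -
    obtain u where "u \<in> phase_set t" "r XOR m < n"
      "\<And>v. v \<in> carrier_vec n \<Longrightarrow> (M *\<^sub>v v) $ r = u * v $ (r XOR m)"
      using xor_monomial_mult_vec[OF assms(1) r] by blast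
    then show ?thesis
      using assms(2) phase_set_subset_gauss_ints by (auto simp: mem_gauss_lattice intro!: gauss_ints_closed)
  qed
  moreover have "M *\<^sub>v l \<in> carrier_vec n"
    using xor_monomial_carrier[OF assms(1)] assms(2) mult_mat_vec_carrier by (auto simp: mem_gauss_lattice)
  ultimately show ?thesis
    by (simp add: mem_gauss_lattice)
qed

text \<open>Half a phase has a coordinate \<open>1 / 2\<close> or \<open>- 1 / 2\<close>, and so
  does half the difference of a real and an imaginary phase. The first claim separates masks, the
  second types.\<close>

lemma phase_half_notin:
  assumes "u \<in> phase_set t" and "u' \<in> phase_set t'"
  shows "u * (1 / 2) \<notin> gauss_ints" and "t \<noteq> t' \<Longrightarrow> u * (1 / 2) - u' * (1 / 2) \<notin> gauss_ints"
proof -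
  have "x \<notin> \<int>" if x: "2 * x = 1 \<or> 2 * x = - 1" for x :: real
  proof
    assume "x \<in> \<int>"
    then obtain i where "x = of_int i"
      by (rule Ints_cases)
    then have "of_int (2 * i) = (1 :: real) \<or> of_int (2 * i) = (- 1 :: real)"
      using x by simp
    then have "2 * i = 1 \<or> 2 * i = - 1"
      by linarith
    then show False
      by presburger
  qed
  then have half: "(1 / 2 :: real) \<notin> \<int>" "(- 1 / 2 :: real) \<notin> \<int>"
    by simp_all
  show "u * (1 / 2) \<notin> gauss_ints" "t \<noteq> t' \<Longrightarrow> u * (1 / 2) - u' * (1 / 2) \<notin> gauss_ints"
    using assms half by (auto simp: phase_set_def gauss_ints_def split: if_splits)
qed

text \<open>Acting on the coset of half a unit vector isolates a column of the matrix modulo 2.\<close>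

lemma torus_act_eq_iff:
  assumes M: "xor_monomial (2 ^ k) m t M" and N: "xor_monomial (2 ^ k) m' t' N"
  shows "(\<forall>X\<in>two_torsion k. torus_act k M X = torus_act k N X) \<longleftrightarrow> m = m' \<and> t = t'"
proof -
  let ?L = "gauss_lattice (2 ^ k)"
  note cM = xor_monomial_carrier[OF M] and cN = xor_monomial_carrier[OF N]
  have act: "torus_act k M (gauss_coset (2 ^ k) v) = torus_act k N (gauss_coset (2 ^ k) v) \<longleftrightarrow>
      M *\<^sub>v v - N *\<^sub>v v \<in> ?L" if v: "v \<in> carrier_vec (2 ^ k)" for v
    using torus_act_coset[OF cM v xor_monomial_gauss_lattice[OF M]]
      torus_act_coset[OF cN v xor_monomial_gauss_lattice[OF N]]
      gauss_coset_eq_iff[of "M *\<^sub>v v" "2 ^ k" "N *\<^sub>v v"] cM cN v by simp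
  have "m = m' \<and> t = t'" if eq: "\<forall>X\<in>two_torsion k. torus_act k M X = torus_act k N X"
  proof -
    \<comment> \<open>Row 0 of \<open>M\<close> has its nonzero entry in column \<open>m\<close>, so
      it picks up the value \<open>1 / 2\<close>; row 0 of \<open>N\<close> does so only if
      \<open>m' = m\<close>.\<close>
    let ?h = "vec (2 ^ k) (\<lambda>i. if i = m then 1 / 2 else 0) :: complex vec"
    have h: "?h \<in> carrier_vec (2 ^ k)" by simp
    have "?h + ?h \<in> ?L"
      by (auto simp: mem_gauss_lattice gauss_ints_def)
    then have "gauss_coset (2 ^ k) ?h \<in> two_torsion k"
      using h mem_two_torsion by blast
    then have "M *\<^sub>v ?h - N *\<^sub>v ?h \<in> ?L"
      by (rule iffD1[OF act[OF h] bspec[OF eq]])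
    then have "(M *\<^sub>v ?h - N *\<^sub>v ?h) $ 0 \<in> gauss_ints"
      unfolding mem_gauss_lattice by simp
    moreover have "(M *\<^sub>v ?h - N *\<^sub>v ?h) $ 0 = (M *\<^sub>v ?h) $ 0 - (N *\<^sub>v ?h) $ 0"
      using cN by (intro index_minus_vec) simp
    ultimately have mem: "(M *\<^sub>v ?h) $ 0 - (N *\<^sub>v ?h) $ 0 \<in> gauss_ints"
      by simp
    obtain u where u: "u \<in> phase_set t" "0 XOR m < 2 ^ k"
      "\<And>v. v \<in> carrier_vec (2 ^ k) \<Longrightarrow> (M *\<^sub>v v) $ 0 = u * v $ (0 XOR m)"
      using xor_monomial_mult_vec[OF M, of 0] by auto
    obtain u' where u': "u' \<in> phase_set t'" "0 XOR m' < 2 ^ k"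
      "\<And>v. v \<in> carrier_vec (2 ^ k) \<Longrightarrow> (N *\<^sub>v v) $ 0 = u' * v $ (0 XOR m')"
      using xor_monomial_mult_vec[OF N, of 0] by auto
    have "u * (1 / 2) - u' * (if m' = m then 1 / 2 else 0) \<in> gauss_ints"
      using mem u(2) u'(2) unfolding u(3)[OF h] u'(3)[OF h] by simp
    then show ?thesis
      using phase_half_notin[OF u(1) u'(1)] by (auto split: if_splits)
  qed
  moreover have "M *\<^sub>v v - N *\<^sub>v v \<in> ?L"
    if eq: "m = m'" "t = t'" and v: "v \<in> carrier_vec (2 ^ k)" "v + v \<in> ?L" for v
  proof -
    have "(M *\<^sub>v v - N *\<^sub>v v) $ r \<in> gauss_ints" if r: "r < 2 ^ k" for r
    proof -
      obtain u where u: "u \<in> phase_set t" "r XOR m < 2 ^ k"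
        "\<And>v. v \<in> carrier_vec (2 ^ k) \<Longrightarrow> (M *\<^sub>v v) $ r = u * v $ (r XOR m)"
        using xor_monomial_mult_vec[OF M r] by blast
      obtain u' where u': "u' \<in> phase_set t"
        "\<And>v. v \<in> carrier_vec (2 ^ k) \<Longrightarrow> (N *\<^sub>v v) $ r = u' * v $ (r XOR m)"
        using xor_monomial_mult_vec[OF N r] eq by blast
      have "(M *\<^sub>v v - N *\<^sub>v v) $ r = (M *\<^sub>v v) $ r - (N *\<^sub>v v) $ r"
        using cN r by (intro index_minus_vec) simp
      then have "(M *\<^sub>v v - N *\<^sub>v v) $ r = (u - u') * v $ (r XOR m)"
        unfolding u(3)[OF v(1)] u'(2)[OF v(1)] by (simp only: left_diff_distrib)
      \<comment> \<open>Phases of one type agree up to sign, so the entry is either 0 or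
        \<open>2 * u\<close> times a coordinate of \<open>v\<close>, a Gaussian integer because
        \<open>v\<close> is half a lattice vector.\<close>
      moreover have "u' = u \<or> u' = - u"
        using u(1) u'(1) by (auto simp: phase_set_def split: if_splits)
      moreover have "v $ (r XOR m) + v $ (r XOR m) \<in> gauss_ints"
        using v u(2) by (auto simp: mem_gauss_lattice)
      then have "u * (v $ (r XOR m) + v $ (r XOR m)) \<in> gauss_ints"
        using u(1) phase_set_subset_gauss_ints by (blast intro: gauss_ints_closed)
      then have "(u + u) * v $ (r XOR m) \<in> gauss_ints"
        by (simp only: distrib_left distrib_right)
      ultimately show ?thesis
        using gauss_ints_closed(1) by (elim disjE) simp_all
    qed
    moreover have "M *\<^sub>v v - N *\<^sub>v v \<in> carrier_vec (2 ^ k)"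
      using cM cN v(1) by (intro minus_carrier_vec mult_mat_vec_carrier)
    ultimately show ?thesis
      unfolding mem_gauss_lattice by blast
  qed
  then have "torus_act k M X = torus_act k N X" if "m = m' \<and> t = t'" and "X \<in> two_torsion k" for X
    using act that unfolding mem_two_torsion by metis
  ultimately show ?thesis
    by blast
qed

section \<open>Classes, shapes and types\<close>

definition xor_shape :: "nat \<Rightarrow> nat \<Rightarrow> nat mat" where
  "xor_shape n m = mat n n (\<lambda>(r, c). if c = r XOR m then 1 else 0)"

lemma shape_xor_monomial:
  assumes "xor_monomial n m t M"
  shows "shape M = xor_shape n m"
proof (rule eq_matI)
  note cM = xor_monomial_carrier[OF assms]
  fix r c assume "r < dim_row (xor_shape n m)" "c < dim_col (xor_shape n m)"
  then have rc: "r < n" "c < n"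
    by (simp_all add: xor_shape_def)
  obtain u where "u \<in> phase_set t" "\<And>c. c < n \<Longrightarrow> M $$ (r, c) = (if c = r XOR m then u else 0)"
    using xor_monomialE[OF assms rc(1)] by blast
  then show "shape M $$ (r, c) = xor_shape n m $$ (r, c)"
    using rc cM phase_set_nonzero by (auto simp: shape_def xor_shape_def)
qed (use xor_monomial_carrier[OF assms] in \<open>auto simp: shape_def xor_shape_def\<close>)

text \<open>The position of the 1 in row 0 reveals the mask.\<close>

lemma xor_shape_inj: "inj_on (xor_shape n) {..<n}"
proof (rule inj_onI)
  fix m m' assume m: "m \<in> {..<n}" "m' \<in> {..<n}" and eq: "xor_shape n m = xor_shape n m'"
  then have "xor_shape n m $$ (0, m) = xor_shape n m' $$ (0, m)"
    by simp
  then show "m = m'"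
    using m by (simp add: xor_shape_def split: if_splits)
qed

text \<open>The nonzero entries form a nonempty subset of \<open>phase_set t\<close>, and the two
  phase sets are disjoint.\<close>

lemma nonzero_entries_xor_monomial:
  assumes M: "xor_monomial n m t M" and "0 < n"
  shows "nonzero_entries M \<subseteq> phase_set t' \<longleftrightarrow> t = t'"
proof -
  note cM = xor_monomial_carrier[OF M]
  have "nonzero_entries M \<subseteq> phase_set t"
  proof
    fix z assume "z \<in> nonzero_entries M"
    then obtain r c where rc: "r < n" "c < n" "z = M $$ (r, c)" "z \<noteq> 0"
      using cM by (fastforce simp: nonzero_entries_def dest: elements_matD)
    then show "z \<in> phase_set t"
      using xor_monomialE[OF M rc(1)] by metis
  qed
  moreover obtain z where "z \<in> nonzero_entries M" "z \<in> phase_set t"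
  proof -
    obtain u where u: "u \<in> phase_set t" "0 XOR m < n"
      "\<And>c. c < n \<Longrightarrow> M $$ (0, c) = (if c = 0 XOR m then u else 0)"
      using xor_monomialE[OF M \<open>0 < n\<close>] by blast
    then have "u \<in> nonzero_entries M"
      using phase_set_nonzero cM \<open>0 < n\<close> by (auto simp: nonzero_entries_def intro!: elements_matI[of M n n 0 m])
    then show ?thesis
      using u that by blast
  qed
  moreover have "phase_set t \<inter> phase_set t' = {}" if "t \<noteq> t'"
    using that by (auto simp: phase_set_def complex_eq_iff)
  ultimately show ?thesis
    by blast
qed

text \<open>Independent of \<open>\<rho>\<close>; the paired argument makes the set of classes an
  image of a product set, which is easily counted.\<close>

definition key_class :: "nat \<Rightarrow> nat \<times> bool \<Rightarrow> (nat list \<Rightarrow> complex) set set" where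
  "key_class k = (\<lambda>(m, t). clifford_word (2 * k) ` key_fibre (2 * k) m t)"

section \<open>Equivalence classes as fibres of mask and type\<close>

lemma increasing_seqs_subset: "\<mu> \<in> increasing_seqs n \<Longrightarrow> set \<mu> \<subseteq> {1..n}"
  by (simp add: increasing_seqs_def)

lemma clifford_word_inj:
  "spin_rep k \<rho> \<Longrightarrow> inj_on (clifford_word (2 * k)) (increasing_seqs (2 * k))"
  using spin_word_inj inj_on_imageI2[of \<rho>] by (auto simp: comp_def)

lemma spin_equiv_words:
  assumes "spin_rep k \<rho>" "\<mu> \<in> increasing_seqs (2 * k)" "\<eta> \<in> increasing_seqs (2 * k)"
  shows "(clifford_word (2 * k) \<mu>, clifford_word (2 * k) \<eta>) \<in> spin_equiv k \<rho> \<longleftrightarrow>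
    spin_mask \<mu> = spin_mask \<eta> \<and> spin_type \<mu> = spin_type \<eta>"
  using torus_act_eq_iff[OF spin_word_monomial[OF assms(1) increasing_seqs_subset[OF assms(2)]]
      spin_word_monomial[OF assms(1) increasing_seqs_subset[OF assms(3)]]] assms
  by (auto simp: spin_equiv_def clifford_generators_def)

lemma spin_equiv_Image:
  assumes "spin_rep k \<rho>" "\<mu> \<in> increasing_seqs (2 * k)"
  shows "spin_equiv k \<rho> `` {clifford_word (2 * k) \<mu>} = key_class k (spin_mask \<mu>, spin_type \<mu>)"
proof -
  have "spin_equiv k \<rho> `` {clifford_word (2 * k) \<mu>} =
      clifford_word (2 * k) ` {\<eta> \<in> increasing_seqs (2 * k).
        (clifford_word (2 * k) \<mu>, clifford_word (2 * k) \<eta>) \<in> spin_equiv k \<rho>}"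
    by (auto simp: spin_equiv_def clifford_generators_def)
  also have "\<dots> = clifford_word (2 * k) ` key_fibre (2 * k) (spin_mask \<mu>) (spin_type \<mu>)"
    using spin_equiv_words[OF assms] unfolding key_fibre_def
    by (intro arg_cong[where f = "image _"]) auto
  finally show ?thesis
    by (simp add: key_class_def)
qed

lemma key_fibre_nonempty: "k \<ge> 1 \<Longrightarrow> m < 2 ^ k \<Longrightarrow> key_fibre (2 * k) m t \<noteq> {}"
  using card_key_fibre_even[of k m t] by auto

text \<open>Masks of words stay below \<open>2 ^ k\<close>; conversely the count shows that every
  such mask occurs with either type.\<close>

lemma spin_classes_eq:
  assumes "k \<ge> 1" "spin_rep k \<rho>"
  shows "spin_classes k \<rho> = key_class k ` ({..<2 ^ k} \<times> UNIV)"
proof (intro equalityI subsetI)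
  fix C assume "C \<in> spin_classes k \<rho>"
  then obtain \<mu> where mu: "\<mu> \<in> increasing_seqs (2 * k)" "C = key_class k (spin_mask \<mu>, spin_type \<mu>)"
    using spin_equiv_Image[OF assms(2)]
    by (auto simp: spin_classes_def clifford_generators_def quotient_def)
  have "spin_mask \<mu> < 2 ^ k"
    using xor_monomial_mask_less[OF spin_word_monomial[OF assms(2) increasing_seqs_subset[OF mu(1)]]] by simp
  then show "C \<in> key_class k ` ({..<2 ^ k} \<times> UNIV)"
    using mu by auto
next
  fix C assume "C \<in> key_class k ` ({..<2 ^ k} \<times> UNIV)"
  then obtain m t where C: "C = key_class k (m, t)" "m < 2 ^ k"
    by auto
  then obtain \<mu> where "\<mu> \<in> key_fibre (2 * k) m t"
    using key_fibre_nonempty[OF assms(1)] by blast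
  then have "\<mu> \<in> increasing_seqs (2 * k)" "C = spin_equiv k \<rho> `` {clifford_word (2 * k) \<mu>}"
    using spin_equiv_Image[OF assms(2)] C by (auto simp: key_fibre_def)
  then show "C \<in> spin_classes k \<rho>"
    by (auto simp: spin_classes_def clifford_generators_def intro: quotientI)
qed

lemma key_class_monomial:
  assumes "spin_rep k \<rho>" "x \<in> key_class k (m, t)"
  shows "xor_monomial (2 ^ k) m t (\<rho> x)"
proof -
  obtain \<mu> where mu: "\<mu> \<in> increasing_seqs (2 * k)" "spin_mask \<mu> = m" "spin_type \<mu> = t"
    and x: "x = clifford_word (2 * k) \<mu>"
    using assms(2) by (auto simp: key_class_def key_fibre_def)
  show ?thesis
    using spin_word_monomial[OF assms(1) increasing_seqs_subset[OF mu(1)]] mu x by simp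
qed

lemma key_class_nonempty: "k \<ge> 1 \<Longrightarrow> m < 2 ^ k \<Longrightarrow> key_class k (m, t) \<noteq> {}"
  using key_fibre_nonempty by (simp add: key_class_def)

text \<open>Nonemptiness of the class is what makes the shape described by \<open>THE\<close>
  unique.\<close>

lemma class_shape_key_class:
  assumes "k \<ge> 1" "spin_rep k \<rho>" "m < 2 ^ k"
  shows "class_shape \<rho> (key_class k (m, t)) = xor_shape (2 ^ k) m"
  unfolding class_shape_def
  using key_class_nonempty[OF assms(1,3), of t] shape_xor_monomial[OF key_class_monomial[OF assms(2)]]
  by (intro the_equality) auto

text \<open>As the class is nonempty, the universal statements about its members are not vacuous and
  determine \<open>t\<close>.\<close>

lemma key_class_type:
  assumes "k \<ge> 1" "spin_rep k \<rho>" "m < 2 ^ k"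
  shows "real_class \<rho> (key_class k (m, t)) \<longleftrightarrow> \<not> t"
    and "imaginary_class \<rho> (key_class k (m, t)) \<longleftrightarrow> t"
proof -
  have type: "(\<forall>x\<in>key_class k (m, t). nonzero_entries (\<rho> x) \<subseteq> phase_set t') \<longleftrightarrow> t = t'" for t'
    using key_class_nonempty[OF assms(1,3), of t]
      nonzero_entries_xor_monomial[OF key_class_monomial[OF assms(2)]] by auto
  show "real_class \<rho> (key_class k (m, t)) \<longleftrightarrow> \<not> t"
    using type[of False] by (simp add: real_class_def real_type_def phase_set_def)
  show "imaginary_class \<rho> (key_class k (m, t)) \<longleftrightarrow> t"
    using type[of True] by (simp add: imaginary_class_def imaginary_type_def phase_set_def)
qed

text \<open>The shape of the class recovers the mask, and being imaginary recovers the type.\<close>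

lemma key_class_inj:
  assumes "k \<ge> 1" "spin_rep k \<rho>"
  shows "inj_on (key_class k) ({..<2 ^ k} \<times> UNIV)"
proof (rule inj_onI)
  fix p q :: "nat \<times> bool"
  assume pq: "p \<in> {..<2 ^ k} \<times> UNIV" "q \<in> {..<2 ^ k} \<times> UNIV" and eq': "key_class k p = key_class k q"
  obtain m t m' t' where p: "p = (m, t)" and q: "q = (m', t')"
    by (cases p, cases q)
  have m: "m \<in> {..<2 ^ k}" "m' \<in> {..<2 ^ k}" and eq: "key_class k (m, t) = key_class k (m', t')"
    using pq eq' p q by auto
  have "xor_shape (2 ^ k) m = xor_shape (2 ^ k) m'"
    using class_shape_key_class[OF assms] m eq by (metis lessThan_iff)
  moreover have "t = t'"
    using key_class_type(2)[OF assms] m eq by (metis lessThan_iff)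
  ultimately show "p = q"
    using xor_shape_inj m p q by (auto dest: inj_onD)
qed

lemma card_key_class:
  assumes "k \<ge> 1" "spin_rep k \<rho>" "m < 2 ^ k"
  shows "card (key_class k (m, t)) = 2 ^ (k - 1)"
proof -
  have "inj_on (clifford_word (2 * k)) (key_fibre (2 * k) m t)"
    using clifford_word_inj[OF assms(2)] by (rule inj_on_subset) (auto simp: key_fibre_def)
  then show ?thesis
    using card_key_fibre_even[OF assms(1)] assms(3) by (simp add: key_class_def card_image)
qed

text \<open>Words are injective on increasing sequences, so each member of the class has a
  well-defined length parity. The value does not depend on \<open>e\<close>, which gives the
  balance.\<close>

lemma card_key_class_parity:
  assumes "k \<ge> 2" "spin_rep k \<rho>" "m < 2 ^ k"
  shows "card {clifford_word (2 * k) \<eta> | \<eta>. \<eta> \<in> increasing_seqs (2 * k) \<and>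
    clifford_word (2 * k) \<eta> \<in> key_class k (m, t) \<and> even (length \<eta>) = e} = 2 ^ (k - 2)"
proof -
  let ?F = "{\<eta> \<in> key_fibre (2 * k) m t. even (length \<eta>) = e}"
  have inj: "inj_on (clifford_word (2 * k)) (increasing_seqs (2 * k))"
    by (rule clifford_word_inj[OF assms(2)])
  have "clifford_word (2 * k) \<eta> \<in> key_class k (m, t) \<longleftrightarrow> \<eta> \<in> key_fibre (2 * k) m t"
    if "\<eta> \<in> increasing_seqs (2 * k)" for \<eta>
    using inj_on_image_mem_iff[OF inj that, of "key_fibre (2 * k) m t"]
    by (auto simp: key_class_def key_fibre_def)
  then have "{clifford_word (2 * k) \<eta> | \<eta>. \<eta> \<in> increasing_seqs (2 * k) \<and>
      clifford_word (2 * k) \<eta> \<in> key_class k (m, t) \<and> even (length \<eta>) = e} =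
    clifford_word (2 * k) ` ?F"
    by (auto simp: key_fibre_def)
  moreover have "inj_on (clifford_word (2 * k)) ?F"
    using inj by (rule inj_on_subset) (auto simp: key_fibre_def)
  moreover have "card ?F = 2 ^ (k - 2)"
    using parity_count_even[OF assms(1), of m t e] assms(3) by (simp add: parity_count_def)
  ultimately show ?thesis
    by (simp add: card_image)
qed

text \<open>The parity balance is asserted for \<open>k >= 2\<close>: at \<open>k = 1\<close> every
  class is a singleton, so one parity is missing from it.\<close>

theorem theorem3p23:
  fixes k :: nat and \<rho> :: "(nat list \<Rightarrow> complex) set \<Rightarrow> complex mat"
  assumes "k \<ge> 1" and "spin_rep k \<rho>"
  shows "(\<forall>C\<in>spin_classes k \<rho>. card C = 2 ^ (k - 1)) \<and>
    (card (spin_classes k \<rho>) = 2 ^ (k + 1) \<and>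
     card {C \<in> spin_classes k \<rho>. real_class \<rho> C} = 2 ^ k \<and>
     card {C \<in> spin_classes k \<rho>. imaginary_class \<rho> C} = 2 ^ k) \<and>
    (card (class_shape \<rho> ` spin_classes k \<rho>) = 2 ^ k \<and>
     (\<forall>s\<in>class_shape \<rho> ` spin_classes k \<rho>.
        \<exists>C D. C \<noteq> D \<and> imaginary_class \<rho> C \<and> real_class \<rho> D \<and>
          {X \<in> spin_classes k \<rho>. class_shape \<rho> X = s} = {C, D})) \<and>
    (k \<ge> 2 \<longrightarrow> (\<forall>C\<in>spin_classes k \<rho>.
        card {clifford_word (2 * k) \<eta> | \<eta>.
          \<eta> \<in> increasing_seqs (2 * k) \<and> clifford_word (2 * k) \<eta> \<in> C \<and> even (length \<eta>)} =
        card {clifford_word (2 * k) \<eta> | \<eta>.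
          \<eta> \<in> increasing_seqs (2 * k) \<and> clifford_word (2 * k) \<eta> \<in> C \<and> odd (length \<eta>)}))"
proof -
  have k: "k \<ge> 1" and rep: "spin_rep k \<rho>" by fact+
  let ?K = "{..<2 ^ k} \<times> UNIV :: (nat \<times> bool) set"
  have classes: "spin_classes k \<rho> = key_class k ` ?K"
    by (rule spin_classes_eq[OF k rep])
  have card_sub: "card (key_class k ` ({..<2 ^ k} \<times> T)) = 2 ^ k * card T" for T
  proof -
    have "inj_on (key_class k) ({..<2 ^ k} \<times> T)"
      using key_class_inj[OF k rep] by (rule inj_on_subset) auto
    then show ?thesis
      by (simp add: card_image card_cartesian_product)
  qed
  \<comment> \<open>Conditions on classes become conditions on pairs of mask and type, where they
    cut out a product set.\<close>
  have filter_image: "{C \<in> f ` A. P C} = f ` {p \<in> A. P (f p)}" for f :: "'p \<Rightarrow> 'q" and A P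
    by blast
  have "{p \<in> ?K. real_class \<rho> (key_class k p)} = {..<2 ^ k} \<times> {False}"
    using key_class_type(1)[OF k rep] by auto
  then have real: "{C \<in> spin_classes k \<rho>. real_class \<rho> C} = key_class k ` ({..<2 ^ k} \<times> {False})"
    unfolding classes filter_image by (rule arg_cong)
  have "{p \<in> ?K. imaginary_class \<rho> (key_class k p)} = {..<2 ^ k} \<times> {True}"
    using key_class_type(2)[OF k rep] by auto
  then have imaginary: "{C \<in> spin_classes k \<rho>. imaginary_class \<rho> C} = key_class k ` ({..<2 ^ k} \<times> {True})"
    unfolding classes filter_image by (rule arg_cong)
  have "class_shape \<rho> (key_class k p) = xor_shape (2 ^ k) (fst p)" if "p \<in> ?K" for p
    using class_shape_key_class[OF k rep] that by (cases p) simp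
  then have "class_shape \<rho> ` spin_classes k \<rho> = (\<lambda>p. xor_shape (2 ^ k) (fst p)) ` ?K"
    unfolding classes image_image by (rule image_cong[OF refl])
  also have "\<dots> = xor_shape (2 ^ k) ` (fst ` ?K)"
    by (simp only: image_image)
  finally have shapes: "class_shape \<rho> ` spin_classes k \<rho> = xor_shape (2 ^ k) ` {..<2 ^ k}"
    by simp
  have size: "card C = 2 ^ (k - 1)" if C: "C \<in> spin_classes k \<rho>" for C
  proof -
    obtain m t where "C = key_class k (m, t)" "m < 2 ^ k"
      using C unfolding classes by auto
    then show ?thesis
      using card_key_class[OF k rep] by simp
  qed
  have number: "card (spin_classes k \<rho>) = 2 ^ (k + 1)"
    unfolding classes card_sub by simp
  have number_real: "card {C \<in> spin_classes k \<rho>. real_class \<rho> C} = 2 ^ k"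
    unfolding real card_sub by simp
  have number_imaginary: "card {C \<in> spin_classes k \<rho>. imaginary_class \<rho> C} = 2 ^ k"
    unfolding imaginary card_sub by simp
  have number_shapes: "card (class_shape \<rho> ` spin_classes k \<rho>) = 2 ^ k"
    unfolding shapes by (simp add: card_image[OF xor_shape_inj])
  have pair: "\<exists>C D. C \<noteq> D \<and> imaginary_class \<rho> C \<and> real_class \<rho> D \<and>
      {X \<in> spin_classes k \<rho>. class_shape \<rho> X = s} = {C, D}"
    if s: "s \<in> class_shape \<rho> ` spin_classes k \<rho>" for s
  proof -
    obtain m where m: "m < 2 ^ k" "s = xor_shape (2 ^ k) m"
      using s unfolding shapes by auto
    have shape_iff: "class_shape \<rho> (key_class k (m', t)) = s \<longleftrightarrow> m' = m" if "m' < 2 ^ k" for m' t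
      using class_shape_key_class[OF k rep that] m inj_onD[OF xor_shape_inj, of "2 ^ k" m' m] that
      by auto
    \<comment> \<open>The shape fixes the mask and leaves both types free, which gives the two
      classes.\<close>
    have "{p \<in> ?K. class_shape \<rho> (key_class k p) = s} = {m} \<times> UNIV"
      using shape_iff m(1) by auto
    then have "{X \<in> spin_classes k \<rho>. class_shape \<rho> X = s} = key_class k ` ({m} \<times> UNIV)"
      unfolding classes filter_image by (rule arg_cong)
    also have "\<dots> = {key_class k (m, True), key_class k (m, False)}"
      by (auto simp: UNIV_bool)
    finally have "{X \<in> spin_classes k \<rho>. class_shape \<rho> X = s} =
        {key_class k (m, True), key_class k (m, False)}" .
    moreover have "imaginary_class \<rho> (key_class k (m, True))" "real_class \<rho> (key_class k (m, False))"
      "\<not> real_class \<rho> (key_class k (m, True))"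
      using key_class_type[OF k rep m(1)] by simp_all
    ultimately show ?thesis
      by (intro exI[of _ "key_class k (m, True)"] exI[of _ "key_class k (m, False)"]) auto
  qed
  have balance: "card {clifford_word (2 * k) \<eta> | \<eta>. \<eta> \<in> increasing_seqs (2 * k) \<and>
        clifford_word (2 * k) \<eta> \<in> C \<and> even (length \<eta>)} =
      card {clifford_word (2 * k) \<eta> | \<eta>. \<eta> \<in> increasing_seqs (2 * k) \<and>
        clifford_word (2 * k) \<eta> \<in> C \<and> odd (length \<eta>)}"
    if k2: "k \<ge> 2" and C: "C \<in> spin_classes k \<rho>" for C
  proof -
    obtain m t where "C = key_class k (m, t)" "m < 2 ^ k"
      using C unfolding classes by auto
    then show ?thesis
      using card_key_class_parity[OF k2 rep, of m t True] card_key_class_parity[OF k2 rep, of m t False]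
      by simp
  qed
  show ?thesis
    by (intro conjI ballI impI size number number_real number_imaginary number_shapes pair balance)
qed

end
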